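(* There exists an absolute constant $C$ such that for all sufficiently large real $T$, $$\max_{t \in [\sqrt{T},\,T]} |\zeta(1+it)| \geq e^{\gamma}\left(\log\log T + \log\log\log T - C\right).$$
   Context: $\zeta$ denotes the Riemann zeta function and $\gamma$ denotes the Euler–Mascheroni constant. *)

theory Defs
  imports "HOL-Complex_Analysis.Complex_Analysis"
begin

definition zeta_continuation :: "real \<Rightarrow> (complex \<Rightarrow> complex) \<Rightarrow> bool" where
  "zeta_continuation c f \<longleftrightarrow>
     f holomorphic_on {z. Re z > c} - {1} \<and>
     (\<forall>z. Re z > 1 \<longrightarrow> (\<lambda>n. 1 / of_nat (Suc n) powr z) sums f z)"

text \<open>
  The Riemann zeta function as the analytic continuation of its Dirichlet series: its value
  at \<open>s\<close> is the common value of the continuations to those punctured half-planes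
  that contain \<open>s\<close>. By the lemma below it does not depend on the half-plane or on the
  continuation chosen. The value at the pole \<open>s = 1\<close> is unspecified.
\<close>

definition riemann_zeta :: "complex \<Rightarrow> complex" where
  "riemann_zeta s = (THE w. \<exists>c f. c < Re s \<and> zeta_continuation c f \<and> w = f s)"

lemma zeta_continuation_unique:
  assumes "zeta_continuation c f" "zeta_continuation d g" "c < Re s" "d < Re s" "s \<noteq> 1"
  shows "f s = g s"
proof (cases "Re s > 1")
  case True
  then show ?thesis
    using assms(1,2) unfolding zeta_continuation_def by (meson sums_unique2)
next
  case False
  define e where "e = max c d"
  define A where "A = {z. Re z > e} - {1::complex}"
  have e: "e < Re s" "e < 1"
    using assms False by (auto simp: e_def)
  have "open {z. Re z > e}" "convex {z. Re z > e}"
    by (auto simp: open_halfspace_Re_gt convex_halfspace_Re_gt)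
  hence A: "open A" "connected A"
    unfolding A_def by (simp_all add: open_delete connected_open_delete convex_connected)
  have hol: "f holomorphic_on A" "g holomorphic_on A"
    using assms(1,2) unfolding zeta_continuation_def A_def e_def
    by (auto elim!: holomorphic_on_subset)
  have eq: "f z = g z" if "z \<in> {z. Re z > 1}" for z
    using that assms(1,2) unfolding zeta_continuation_def by (auto intro: sums_unique2)
  have "{z. Re z > 1} \<noteq> {}"
    by (auto intro!: exI[of _ 2])
  moreover have "{z. Re z > 1} \<subseteq> A"
    using e by (auto simp: A_def)
  ultimately show ?thesis
    using analytic_continuation_open[of "{z. Re z > 1}" A f g s]
      A hol eq e assms(5) by (auto simp: open_halfspace_Re_gt A_def)
qed

corollary riemann_zeta_eq:
  assumes "zeta_continuation c f" "c < Re s" "s \<noteq> 1"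
  shows "riemann_zeta s = f s"
  unfolding riemann_zeta_def
  by (rule the_equality) (use assms zeta_continuation_unique in blast)+

end

theory Submission
  imports Defs "HOL-Real_Asymp.Real_Asymp"
begin

text \<open>
  This is the long resonator method, run on the Dirichlet polynomial
  \<open>D t = (\<Sum>k\<le>N. k powr (-1 - i t))\<close>, which approximates the zeta function on the 1-line up to \<open>O(1)\<close>
  as soon as \<open>N \<ge> T\<close>. The resonator \<open>R t = (\<Prod>p\<le>X. 1 / (1 - q p * p powr (i t)))\<close> with
  \<open>q p = 1 - p / X\<close> is the Dirichlet series of a completely multiplicative \<open>q \<ge> 0\<close>. Hence, for every \<open>k\<close> all of
  whose prime factors are at most \<open>X\<close>, the difference \<open>k powr (-i t) * R t - q k * R t\<close> still
  has nonnegative coefficients. The weight \<open>1 - t / T\<close> on \<open>[0, T]\<close> has a nonnegative cosine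
  transform, so it follows that the average of \<open>Re (D t)\<close> against \<open>(1 - t / T) * |R t|^2\<close> is at least
  \<open>\<Sum>k. q k / k\<close>, the sum over a large set of such \<open>k\<close>. This sum is
  \<open>(\<Prod>p\<le>X. 1 / (1 - 1 / p)) * (1 - O(1 / ln X))\<close>, hence at least
  \<open>exp \<gamma> * (ln X - O(1))\<close> by a quantitative form of Mertens' third theorem. Chebyshev's bound
  gives \<open>|R t| \<le> exp (O(X / ln X))\<close>. Therefore \<open>X\<close> can be taken to be a small multiple of
  \<open>ln T * ln (ln T)\<close> and the range \<open>t < sqrt T\<close> still contributes only \<open>O(1)\<close>. Since \<open>N\<close> enters
  that contribution only through \<open>ln N\<close>, it can be so large that no truncation error arises.
\<close>

subsection \<open>Chebyshev's bound and Mertens' first theorem\<close>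

definition primes_upto :: "nat \<Rightarrow> nat set" where
  "primes_upto n = {p. prime p \<and> p \<le> n}"

lemma finite_primes_upto [simp]: "finite (primes_upto n)"
  unfolding primes_upto_def by (rule finite_subset[of _ "{..n}"]) auto

lemma primes_upto_ge_2: "p \<in> primes_upto n \<Longrightarrow> p \<ge> 2"
  by (auto simp: primes_upto_def prime_ge_2_nat)

lemma primes_upto_mono: "m \<le> n \<Longrightarrow> primes_upto m \<subseteq> primes_upto n"
  by (auto simp: primes_upto_def)

lemma prod_primes_dvd:
  fixes N :: nat
  assumes "finite A" "\<And>p. p \<in> A \<Longrightarrow> prime p" "\<And>p. p \<in> A \<Longrightarrow> p dvd N"
  shows "\<Prod>A dvd N"
  using assms
proof (induction A rule: finite_induct)
  case (insert p A)
  have "coprime p (\<Prod>A)"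
    by (rule prod_coprime_right) (use insert in \<open>auto intro!: primes_coprime\<close>)
  thus ?case using insert by (simp add: divides_mult)
qed auto

text \<open>Each prime in \<open>(m + 1, 2 m + 1]\<close> divides the numerator of
  \<open>(2 m + 1) choose m\<close> but neither factorial below it. The binomial coefficient is at
  most \<open>4 ^ m\<close>, since it occurs twice in a row whose sum is
  \<open>2 * 4 ^ m\<close>.\<close>

lemma theta_odd_step:
  "(\<Sum>p\<in>primes_upto (2*m+1). ln (real p)) \<le> (\<Sum>p\<in>primes_upto (m+1). ln (real p)) + m * ln 4"
proof -
  define A where "A = primes_upto (2*m+1) - primes_upto (m+1)"
  have fA: "finite A" by (simp add: A_def)
  have "\<Prod>A dvd (2*m+1) choose m"
  proof (rule prod_primes_dvd[OF fA])
    fix p assume p: "p \<in> A"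
    show pr: "prime p" using p by (auto simp: A_def primes_upto_def)
    have "fact m * fact (2*m+1-m) * ((2*m+1) choose m) = (fact (2*m+1) :: nat)"
      by (rule binomial_fact_lemma) auto
    moreover have "p dvd fact (2*m+1)" using p pr
      by (subst prime_dvd_fact_iff) (auto simp: A_def primes_upto_def)
    moreover have "\<not> p dvd fact m" "\<not> p dvd fact (2*m+1-m)" using p pr
      by (auto simp: prime_dvd_fact_iff A_def primes_upto_def simp del: fact_Suc)
    ultimately show "p dvd (2*m+1) choose m"
      using pr by (metis prime_dvd_mult_iff)
  qed
  hence "\<Prod>A \<le> (2*m+1) choose m" by (intro dvd_imp_le) auto
  also have "((2*m+1) choose m) \<le> 4 ^ m"
  proof -
    have "2 * ((2*m+1) choose m) = (\<Sum>k\<in>{m, Suc m}. (2*m+1) choose k)"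
      using binomial_symmetric[of m "2*m+1"] by simp
    also have "\<dots> \<le> (\<Sum>k\<le>2*m+1. (2*m+1) choose k)" by (intro sum_mono2) auto
    also have "\<dots> = 2 * 4 ^ m" by (subst choose_row_sum) (simp add: power_mult)
    finally show ?thesis by simp
  qed
  finally have le: "real (\<Prod>A) \<le> 4 ^ m" by (metis of_nat_le_iff of_nat_numeral of_nat_power)
  have A0: "p > 0" if "p \<in> A" for p using that by (auto simp: A_def primes_upto_def prime_gt_0_nat)
  have "(\<Sum>p\<in>A. ln (real p)) = ln (real (\<Prod>A))"
    using A0 fA by (simp add: ln_prod)
  also have "\<dots> \<le> ln (4 ^ m)" 
    using le A0 by (subst ln_le_cancel_iff) (auto intro!: prod_pos)
  also have "\<dots> = m * ln 4" by (simp add: ln_realpow)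
  finally have "(\<Sum>p\<in>A. ln (real p)) \<le> m * ln 4" .
  moreover have "(\<Sum>p\<in>primes_upto (2*m+1). ln (real p)) = (\<Sum>p\<in>A. ln (real p)) + (\<Sum>p\<in>primes_upto (m+1). ln (real p))"
    unfolding A_def by (intro sum.subset_diff primes_upto_mono) auto
  ultimately show ?thesis by simp
qed

lemma theta_le: "(\<Sum>p\<in>primes_upto n. ln (real p)) \<le> n * ln 4"
proof (induction n rule: less_induct)
  case (less n)
  consider "n \<le> 1" | "n = 2" | "n > 2" "even n" | "n > 2" "odd n" by linarith
  thus ?case
  proof cases
    case 1
    hence "primes_upto n = {}" using primes_upto_ge_2[of _ n] by (force simp: primes_upto_def)
    thus ?thesis by simp
  next
    case 2
    hence "primes_upto n = {2}" by (auto simp: primes_upto_def dest: prime_ge_2_nat)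
    thus ?thesis using 2 ln_realpow[of 2 2] by simp
  next
    case 3
    have "\<not> prime n" using 3 primes_dvd_imp_eq two_is_prime_nat by blast
    hence "primes_upto n = primes_upto (n - 1)"
      using 3 by (auto simp: primes_upto_def) (metis One_nat_def Suc_pred le_SucE less_imp_le_nat order.strict_trans zero_less_numeral)
    moreover have "real (n-1) * ln 4 \<le> n * ln 4" by (intro mult_right_mono) auto
    moreover have "(\<Sum>p\<in>primes_upto (n-1). ln (real p)) \<le> real (n-1) * ln 4"
      using 3 by (intro less.IH) auto
    ultimately show ?thesis by (metis order_trans)
  next
    case 4
    then obtain m where m: "n = 2*m+1" by (elim oddE)
    have "(\<Sum>p\<in>primes_upto (m+1). ln (real p)) \<le> (m+1) * ln 4"
      using 4 m by (intro less.IH) auto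
    thus ?thesis using theta_odd_step[of m] m by (simp add: algebra_simps)
  qed
qed

section \<open>Legendre's formula\<close>

lemma card_multiples:
  fixes d :: nat assumes "d > 0"
  shows "card {m\<in>{1..n}. d dvd m} = n div d"
proof -
  have "{m\<in>{1..n}. d dvd m} = (\<lambda>k. k * d) ` {1..n div d}"
  proof (intro equalityI subsetI)
    fix m assume "m \<in> {m\<in>{1..n}. d dvd m}"
    then obtain k where "m = k * d" "1 \<le> m" "m \<le> n" by (auto simp: mult.commute elim!: dvdE)
    thus "m \<in> (\<lambda>k. k * d) ` {1..n div d}" using assms
      by (auto simp: less_eq_div_iff_mult_less_eq Suc_le_eq intro!: imageI)
  qed (use assms in \<open>auto simp: less_eq_div_iff_mult_less_eq Suc_le_eq\<close>)
  thus ?thesis using assms by (simp add: card_image inj_on_def)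
qed

text \<open>The cutoff \<open>n\<close> does not depend on \<open>m\<close>, so that sums over
  \<open>m\<close> can be interchanged. It loses nothing because the multiplicity \<open>e\<close>
  satisfies \<open>e < p ^ e <= m\<close>.\<close>

lemma multiplicity_eq_card:
  assumes "prime p" "1 \<le> m" "m \<le> (n::nat)"
  shows "multiplicity p m = card {k\<in>{1..n}. p ^ k dvd m}"
proof -
  have iff: "p ^ k dvd m \<longleftrightarrow> k \<le> multiplicity p m" for k
    using assms by (intro power_dvd_iff_le_multiplicity) (auto simp: prime_gt_1_nat)
  have "multiplicity p m < p ^ multiplicity p m" using assms(1)
    using prime_gt_1_nat[of p] by (intro power_gt_expt) auto
  also have "p ^ multiplicity p m \<le> m" using assms by (intro dvd_imp_le multiplicity_dvd) auto
  finally have "multiplicity p m \<le> n" using assms by linarith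
  hence "{k\<in>{1..n}. p ^ k dvd m} = {1..multiplicity p m}" unfolding iff by auto
  thus ?thesis by simp
qed

text \<open>Legendre's formula for the exponent of \<open>p\<close> in \<open>fact n\<close>, by
  double counting the pairs \<open>(m, k)\<close> with \<open>p ^ k dvd m\<close>; the summands with
  \<open>p ^ k > n\<close> vanish.\<close>

lemma sum_multiplicity:
  assumes "prime p"
  shows "(\<Sum>m=1..n. multiplicity p m) = (\<Sum>k=1..n. n div p ^ k)"
proof -
  have "(\<Sum>m=1..n. multiplicity p m) = (\<Sum>m=1..n. \<Sum>k=1..n. if p ^ k dvd m then 1 else 0)"
    using assms by (intro sum.cong refl) (simp add: multiplicity_eq_card[where n = n] sum.If_cases Int_def)
  also have "\<dots> = (\<Sum>k=1..n. \<Sum>m=1..n. if p ^ k dvd m then 1 else 0)" by (rule sum.swap)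
  also have "\<dots> = (\<Sum>k=1..n. card {m\<in>{1..n}. p ^ k dvd m})"
    by (intro sum.cong refl) (simp add: sum.If_cases Int_def)
  also have "\<dots> = (\<Sum>k=1..n. n div p ^ k)"
    using assms by (intro sum.cong refl card_multiples) (auto simp: prime_gt_0_nat)
  finally show ?thesis .
qed

lemma nat_eq_prod_primes_upto:
  assumes "1 \<le> m" "m \<le> n"
  shows "m = (\<Prod>p\<in>primes_upto n. p ^ multiplicity p m)"
proof -
  have "m = (\<Prod>p\<in>prime_factors m. p ^ multiplicity p m)"
    using assms by (intro prime_factorization_nat) auto
  also have "\<dots> = (\<Prod>p\<in>primes_upto n. p ^ multiplicity p m)"
  proof (rule prod.mono_neutral_left)
    show "prime_factors m \<subseteq> primes_upto n"
      using assms by (auto simp: primes_upto_def prime_factors_dvd dest!: dvd_imp_le)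
    show "\<forall>i\<in>primes_upto n - prime_factors m. i ^ multiplicity i m = 1"
      using assms by (auto simp: primes_upto_def prime_factors_dvd not_dvd_imp_multiplicity_0)
  qed auto
  finally show ?thesis .
qed

lemma ln_eq_sum_primes:
  assumes "1 \<le> m" "m \<le> n"
  shows "ln (real m) = (\<Sum>p\<in>primes_upto n. multiplicity p m * ln (real p))"
proof -
  have "ln (real m) = ln (\<Prod>p\<in>primes_upto n. real p ^ multiplicity p m)"
    using nat_eq_prod_primes_upto[OF assms]
    by (metis (mono_tags, lifting) of_nat_power of_nat_prod prod.cong)
  also have "\<dots> = (\<Sum>p\<in>primes_upto n. ln (real p ^ multiplicity p m))"
    by (intro ln_prod) (auto dest!: primes_upto_ge_2)
  finally show ?thesis by (simp add: ln_realpow)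
qed

lemma ln_fact_eq:
  "ln (fact n) = (\<Sum>p\<in>primes_upto n. ln (real p) * (\<Sum>k=1..n. n div p ^ k))"
proof -
  have "ln (fact n :: real) = (\<Sum>m=1..n. ln (real m))"
    by (subst fact_prod, subst of_nat_prod, subst ln_prod) auto
  also have "\<dots> = (\<Sum>m=1..n. \<Sum>p\<in>primes_upto n. multiplicity p m * ln (real p))"
    by (intro sum.cong refl ln_eq_sum_primes) auto
  also have "\<dots> = (\<Sum>p\<in>primes_upto n. ln (real p) * real (\<Sum>m=1..n. multiplicity p m))"
    by (subst sum.swap) (simp add: sum_distrib_left mult.commute)
  also have "\<dots> = (\<Sum>p\<in>primes_upto n. ln (real p) * (\<Sum>k=1..n. n div p ^ k))"
    by (intro sum.cong refl) (subst sum_multiplicity, auto simp: primes_upto_def)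
  finally show ?thesis .
qed

section \<open>Mertens' first theorem\<close>

lemma ln_fact_ge: "ln (fact n :: real) \<ge> n * ln n - n"
proof (induction n)
  case (Suc n)
  have "n * (ln (real (Suc n)) - ln n) \<le> 1"
  proof (cases "n = 0")
    case False
    have "ln (real (Suc n)) - ln n = ln (1 + 1 / n)"
      using False by (subst ln_divide_pos[symmetric]) (auto simp: field_simps)
    also have "\<dots> \<le> 1 / n" by (rule ln_add_one_self_le_self) auto
    finally show ?thesis using False by (simp add: field_simps)
  qed auto
  moreover have "ln (fact (Suc n) :: real) = ln (fact n) + ln (real (Suc n))"
    by (simp add: ln_mult)
  ultimately show ?case using Suc by (simp add: algebra_simps)
qed auto

lemma ln_fact_le: "ln (fact n :: real) \<le> n * ln n"
proof (cases "n = 0")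
  case False
  have "fact n \<le> real n ^ n" by (metis fact_le_power le_refl of_nat_fact of_nat_le_iff of_nat_power)
  hence "ln (fact n :: real) \<le> ln (real n ^ n)" using False by (subst ln_le_cancel_iff) auto
  thus ?thesis using False by (simp add: ln_realpow)
qed auto

text \<open>Only the term \<open>k = 1\<close> of Legendre's formula is kept. Replacing
  \<open>n div p\<close> by \<open>n / p - 1\<close> costs the sum of \<open>ln p\<close>, which
  Chebyshev's bound controls.\<close>

lemma mertens_first_upper:
  assumes "n \<ge> 1"
  shows "(\<Sum>p\<in>primes_upto n. ln (real p) / p) \<le> ln n + ln 4"
proof -
  have "n * (\<Sum>p\<in>primes_upto n. ln (real p) / p) - (\<Sum>p\<in>primes_upto n. ln (real p))
      = (\<Sum>p\<in>primes_upto n. ln (real p) * (n / p - 1))"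
    by (simp add: sum_distrib_left sum_subtractf algebra_simps)
  also have "\<dots> \<le> (\<Sum>p\<in>primes_upto n. ln (real p) * (\<Sum>k=1..n. n div p ^ k))"
  proof (intro sum_mono mult_left_mono)
    fix p assume p: "p \<in> primes_upto n"
    have "real n / p - 1 \<le> real (n div p)"
    proof -
      have "n = p * (n div p) + n mod p" by simp
      moreover have "n mod p < p" using primes_upto_ge_2[OF p] by simp
      ultimately have "n \<le> p * (n div p) + p" by linarith
      hence "real n \<le> real (p * (n div p) + p)" by (simp only: of_nat_le_iff)
      thus ?thesis using primes_upto_ge_2[OF p] by (simp add: field_simps)
    qed
    also have "n div p \<le> (\<Sum>k=1..n. n div p ^ k)"
      using assms member_le_sum[of 1 "{1..n}" "\<lambda>k. n div p ^ k"] by simp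
    finally show "real n / p - 1 \<le> real (\<Sum>k=1..n. n div p ^ k)" by simp
    show "ln (real p) \<ge> 0" using primes_upto_ge_2[OF p] by simp
  qed
  also have "\<dots> \<le> n * ln n" using ln_fact_le[of n] ln_fact_eq[of n] by simp
  finally have "n * (\<Sum>p\<in>primes_upto n. ln (real p) / p) \<le> n * (ln n + ln 4)"
    using theta_le[of n] by (simp add: algebra_simps)
  thus ?thesis using assms by simp
qed

text \<open>Here all powers of \<open>p\<close> in Legendre's formula are kept:
  \<open>n div p ^ k <= n / p ^ k\<close>, and the geometric series is at most
  \<open>1 / p + 2 / p ^ 2\<close>. The excess, weighted by \<open>ln p\<close>, forms a convergent
  series.\<close>

lemma mertens_first_lower:
  obtains C where "C \<ge> 0"
    "\<And>n. n \<ge> 1 \<Longrightarrow> (\<Sum>p\<in>primes_upto n. ln (real p) / p) \<ge> ln n - C"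
proof
  let ?f = "\<lambda>n::nat. real n powr (-3/2)"
  \<comment> \<open>The 1 comes from \<open>ln_fact_ge\<close>; the 4 is the factor 2 in
    \<open>2 / p ^ 2\<close> times the 2 in \<open>ln p <= 2 * sqrt p\<close>, which also yields the
    exponent \<open>-3/2\<close>.\<close>
  define C where "C = 1 + 4 * suminf ?f"
  have sm: "summable ?f" by (subst summable_real_powr_iff) auto
  show "C \<ge> 0" unfolding C_def using suminf_nonneg[OF sm] by simp
  fix n :: nat assume n: "n \<ge> 1"
  have "n * ln n - n \<le> (\<Sum>p\<in>primes_upto n. ln (real p) * (\<Sum>k=1..n. n div p ^ k))"
    using ln_fact_ge[of n] ln_fact_eq[of n] by simp
  also have "\<dots> \<le> (\<Sum>p\<in>primes_upto n. n * (ln (real p) / p + 4 * ?f p))"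
  proof (intro sum_mono)
    fix p assume p: "p \<in> primes_upto n"
    note p2 = primes_upto_ge_2[OF p]
    have "real (\<Sum>k=1..n. n div p ^ k) \<le> (\<Sum>k=1..n. n * (1/p) ^ k)"
      unfolding of_nat_sum
    proof (intro sum_mono)
      fix k
      have "real (n div p ^ k * p ^ k) \<le> real n"
        by (simp only: of_nat_le_iff div_times_less_eq_dividend)
      hence "real (n div p ^ k) * real p ^ k \<le> real n" by simp
      thus "real (n div p ^ k) \<le> n * (1/p) ^ k"
        using p2 by (simp add: power_one_over field_simps)
    qed
    also have "\<dots> = n * (\<Sum>k=1..n. (1/p) ^ k)" by (simp add: sum_distrib_left)
    also have "\<dots> \<le> n * (1 / (real p - 1))"
    proof (rule mult_left_mono)
      have "(\<Sum>k=1..n. (1/p) ^ k) = ((1/p) ^ 1 - (1/p) ^ Suc n) / (1 - 1/p)"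
        using p2 n by (subst sum_gp) auto
      also have "\<dots> \<le> (1/p) / (1 - 1/p)"
        using p2 by (intro divide_right_mono) auto
      also have "\<dots> = 1 / (real p - 1)" using p2 by (simp add: field_simps)
      finally show "(\<Sum>k=1..n. (1/p) ^ k) \<le> 1 / (real p - 1)" .
    qed auto
    also have "1 / (real p - 1) = 1 / p + 1 / (p * (real p - 1))" using p2 by (simp add: field_simps)
    also have "n * (1 / p + 1 / (p * (real p - 1))) \<le> n * (1 / p + 2 / (real p ^ 2))"
      using p2 by (intro mult_left_mono add_left_mono) (auto simp: field_simps power2_eq_square)
    finally have "ln (real p) * real (\<Sum>k=1..n. n div p ^ k) \<le> ln (real p) * (n * (1 / p + 2 / (real p ^ 2)))"
      using p2 by (intro mult_left_mono) auto
    also have "\<dots> = n * (ln (real p) / p + 2 * ln (real p) / real p ^ 2)"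
      by (simp add: algebra_simps)
    finally have le1: "ln (real p) * real (\<Sum>k=1..n. n div p ^ k) \<le> \<dots>" .
    have "ln (real p) \<le> 2 * real p powr (1/2)"
      using ln_powr_bound[of p "1/2"] p2 by simp
    hence "2 * ln (real p) / real p ^ 2 \<le> 2 * (2 * real p powr (1/2)) / real p ^ 2"
      by (intro divide_right_mono mult_left_mono) auto
    also have "\<dots> = 4 * (real p powr (1/2) / real p powr 2)" using p2 by simp
    also have "real p powr (1/2) / real p powr 2 = ?f p" using p2 by (subst powr_diff[symmetric]) auto
    finally have "ln (real p) / p + 2 * ln (real p) / real p ^ 2 \<le> ln (real p) / p + 4 * ?f p" by simp
    hence "n * (ln (real p) / p + 2 * ln (real p) / real p ^ 2) \<le> n * (ln (real p) / p + 4 * ?f p)"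
      by (rule mult_left_mono) auto
    with le1 show "ln (real p) * (\<Sum>k=1..n. n div p ^ k) \<le> n * (ln (real p) / p + 4 * ?f p)"
      by linarith
  qed
  also have "\<dots> = n * ((\<Sum>p\<in>primes_upto n. ln (real p) / p) + 4 * (\<Sum>p\<in>primes_upto n. ?f p))"
    by (simp add: sum_distrib_left sum.distrib algebra_simps)
  also have "\<dots> \<le> n * ((\<Sum>p\<in>primes_upto n. ln (real p) / p) + 4 * suminf ?f)"
    by (intro mult_left_mono add_left_mono sum_le_suminf sm) auto
  finally have "n * (ln n - 1) \<le> n * ((\<Sum>p\<in>primes_upto n. ln (real p) / p) + 4 * suminf ?f)"
    by (simp add: algebra_simps)
  thus "(\<Sum>p\<in>primes_upto n. ln (real p) / p) \<ge> ln n - C" using n by (simp add: C_def)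
qed

section \<open>Bounds of order \<open>n / ln n\<close>\<close>

lemma sqrt_le_div_ln:
  fixes x :: real
  assumes "x > 1"
  shows "sqrt x \<le> 2 * (x / ln x)"
proof -
  have "ln x \<le> 2 * sqrt x" using ln_powr_bound[of x "1/2"] assms by (simp add: powr_half_sqrt)
  hence "sqrt x * ln x \<le> sqrt x * (2 * sqrt x)" using assms by (intro mult_left_mono) auto
  also have "\<dots> = 2 * x" using assms by simp
  finally show ?thesis using assms by (simp add: pos_le_divide_eq)
qed

text \<open>Split at \<open>sqrt n\<close>. The larger primes each contribute at least
  \<open>ln n / 2\<close> to the sum bounded by \<open>theta_le\<close>; the smaller ones are at
  most \<open>sqrt n\<close> in number, which \<open>sqrt_le_div_ln\<close> absorbs.\<close>

lemma card_primes_upto_le: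
  assumes "n \<ge> 2"
  shows "card (primes_upto n) \<le> (2 + 2 * ln 4) * (n / ln n)"
proof -
  let ?A = "{p\<in>primes_upto n. real p > sqrt n}" and ?B = "{p\<in>primes_upto n. real p \<le> sqrt n}"
  have ln0: "ln (real n) > 0" using assms by simp
  have "card ?A * (ln n / 2) = (\<Sum>p\<in>?A. ln n / 2)" by simp
  also have "\<dots> \<le> (\<Sum>p\<in>?A. ln (real p))"
  proof (intro sum_mono)
    fix p assume p: "p \<in> ?A"
    have "ln (sqrt n) \<le> ln (real p)" using p assms by (subst ln_le_cancel_iff) (auto dest: primes_upto_ge_2)
    thus "ln n / 2 \<le> ln (real p)" using assms by (simp add: ln_sqrt)
  qed
  also have "\<dots> \<le> (\<Sum>p\<in>primes_upto n. ln (real p))"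
    by (intro sum_mono2) (auto dest: primes_upto_ge_2)
  also have "\<dots> \<le> n * ln 4" by (rule theta_le)
  finally have A: "card ?A \<le> 2 * ln 4 * (n / ln n)" using ln0 by (simp add: field_simps)
  have "?B \<subseteq> {1..nat \<lfloor>sqrt n\<rfloor>}" by (auto dest: primes_upto_ge_2 simp: le_nat_iff le_floor_iff)
  hence "card ?B \<le> nat \<lfloor>sqrt n\<rfloor>" by (metis card_atLeastAtMost card_mono diff_Suc_1 finite_atLeastAtMost)
  hence "real (card ?B) \<le> sqrt n" by (simp add: le_nat_iff le_floor_iff)
  also have "\<dots> \<le> 2 * (n / ln n)"
    using assms by (intro sqrt_le_div_ln) auto
  finally have B: "card ?B \<le> 2 * (n / ln n)" .
  have "primes_upto n = ?A \<union> ?B" by auto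
  hence "card (primes_upto n) \<le> card ?A + card ?B" by (metis card_Un_le)
  thus ?thesis using A B by (simp add: algebra_simps)
qed

lemma sum_inverse_ln_le:
  assumes "n \<ge> 2"
  shows "(\<Sum>j=2..<n. 1 / ln (real j)) \<le> (2 / ln 2 + 2) * (n / ln n)"
proof -
  have ln0: "ln (real n) > 0" using assms by simp
  have "(\<Sum>j=2..<n. 1 / ln (real j)) \<le> (\<Sum>j=2..<n. (if real j \<le> sqrt n then 1 / ln 2 else 0) + 2 / ln n)"
  proof (intro sum_mono)
    fix j assume j: "j \<in> {2..<n}"
    show "1 / ln (real j) \<le> (if real j \<le> sqrt n then 1 / ln 2 else 0) + 2 / ln n"
    proof (cases "real j \<le> sqrt n")
      case True
      have "1 / ln (real j) \<le> 1 / ln 2" using j by (intro divide_left_mono) auto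
      thus ?thesis using True ln0 by (simp add: add_increasing2)
    next
      case False
      have "ln (sqrt n) \<le> ln (real j)" using False j assms by (subst ln_le_cancel_iff) auto
      hence "ln n / 2 \<le> ln (real j)" using assms by (simp add: ln_sqrt)
      hence "1 / ln (real j) \<le> 1 / (ln n / 2)" using ln0 j by (intro divide_left_mono) auto
      thus ?thesis using False by simp
    qed
  qed
  also have "\<dots> = card {j\<in>{2..<n}. real j \<le> sqrt n} * (1 / ln 2) + (n - 2) * (2 / ln n)"
    by (simp add: sum.distrib sum.If_cases Int_def)
  also have "\<dots> \<le> sqrt n * (1 / ln 2) + n * (2 / ln n)"
  proof (intro add_mono mult_right_mono)
    have "{j\<in>{2..<n}. real j \<le> sqrt n} \<subseteq> {1..nat \<lfloor>sqrt n\<rfloor>}" by (auto simp: le_nat_iff le_floor_iff)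
    hence "card {j\<in>{2..<n}. real j \<le> sqrt n} \<le> nat \<lfloor>sqrt n\<rfloor>"
      by (metis card_atLeastAtMost card_mono diff_Suc_1 finite_atLeastAtMost)
    thus "real (card {j\<in>{2..<n}. real j \<le> sqrt n}) \<le> sqrt n" by (simp add: le_nat_iff le_floor_iff)
  qed (use ln0 in auto)
  also have "sqrt n \<le> 2 * (n / ln n)"
    using assms by (intro sqrt_le_div_ln) auto
  hence "sqrt n * (1 / ln 2) \<le> 2 * (n / ln n) * (1 / ln 2)" by (intro mult_right_mono) auto
  finally show ?thesis by (simp add: algebra_simps)
qed

text \<open>For \<open>n = X\<close> this sum is the logarithm of the maximum of the resonator.
  Writing \<open>ln n - ln p\<close> as a sum of increments, each at most \<open>1 / j\<close>, and
  interchanging the sums gives the sum of \<open>card (primes_upto j) / j\<close>, whose terms are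
  \<open>O(1 / ln j)\<close>.\<close>

lemma sum_ln_deficit_le:
  obtains C where "C \<ge> 0"
    "\<And>n. n \<ge> 2 \<Longrightarrow> (\<Sum>p\<in>primes_upto n. ln (real n) - ln (real p)) \<le> C * (n / ln n)"
proof
  define B where "B = (2 + 2 * ln 4 :: real)"
  have B0: "B \<ge> 0" by (simp add: B_def)
  define C where "C = B * (2 / ln 2 + 2)"
  show "C \<ge> 0" using B0 by (simp add: C_def)
  fix n :: nat assume n: "n \<ge> 2"
  have "(\<Sum>p\<in>primes_upto n. ln (real n) - ln (real p)) \<le> (\<Sum>p\<in>primes_upto n. \<Sum>j=2..<n. if p \<le> j then 1 / j else 0)"
  proof (intro sum_mono)
    fix p assume p: "p \<in> primes_upto n"
    hence p2: "p \<ge> 2" and pn: "p \<le> n" by (auto simp: primes_upto_def prime_ge_2_nat)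
    have "ln (real n) - ln (real p) = (\<Sum>j=p..<n. ln (real (Suc j)) - ln (real j))"
      using sum_Suc_diff'[OF pn, of "\<lambda>j. ln (real j)"] by simp
    also have "\<dots> \<le> (\<Sum>j=p..<n. 1 / j)"
    proof (intro sum_mono)
      fix j assume j: "j \<in> {p..<n}"
      have "ln (real (Suc j)) - ln j = ln (1 + 1 / j)"
        using j p2 by (subst ln_divide_pos[symmetric]) (auto simp: field_simps)
      also have "\<dots> \<le> 1 / j" by (rule ln_add_one_self_le_self) auto
      finally show "ln (real (Suc j)) - ln j \<le> 1 / j" .
    qed
    also have "\<dots> = (\<Sum>j=2..<n. if p \<le> j then 1 / j else 0)"
      using p2 by (intro sum.mono_neutral_cong_left) auto
    finally show "ln (real n) - ln (real p) \<le> (\<Sum>j=2..<n. if p \<le> j then 1 / j else 0)" .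
  qed
  also have "\<dots> = (\<Sum>j=2..<n. \<Sum>p\<in>primes_upto n. if p \<le> j then 1 / j else 0)" by (rule sum.swap)
  also have "\<dots> = (\<Sum>j=2..<n. card (primes_upto j) / j)"
  proof (intro sum.cong refl)
    fix j assume "j \<in> {2..<n}"
    hence "primes_upto n \<inter> {p. p \<le> j} = primes_upto j" by (auto simp: primes_upto_def)
    thus "(\<Sum>p\<in>primes_upto n. if p \<le> j then 1 / j else 0) = card (primes_upto j) / real j"
      by (simp add: sum.If_cases)
  qed
  also have "\<dots> \<le> (\<Sum>j=2..<n. B * (1 / ln (real j)))"
  proof (intro sum_mono)
    fix j assume j: "j \<in> {2..<n}"
    have "card (primes_upto j) / real j \<le> (B * (j / ln j)) / real j"
      unfolding B_def using j by (intro divide_right_mono card_primes_upto_le) auto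
    thus "card (primes_upto j) / real j \<le> B * (1 / ln (real j))" using j by (simp add: field_simps)
  qed
  also have "\<dots> = B * (\<Sum>j=2..<n. 1 / ln (real j))" by (simp add: sum_distrib_left)
  also have "\<dots> \<le> B * ((2 / ln 2 + 2) * (n / ln n))"
    using B0 n by (intro mult_left_mono sum_inverse_ln_le)
  finally show "(\<Sum>p\<in>primes_upto n. ln (real n) - ln (real p)) \<le> C * (n / ln n)"
    by (simp add: C_def mult.assoc)
qed

section \<open>Finite Euler products\<close>

text \<open>A finite substitute for the integers with all prime factors in \<open>A\<close>.
  Exponent vectors are extensional functions, so each one is represented once.\<close>

definition prime_power_products :: "nat set \<Rightarrow> nat \<Rightarrow> nat set" where
  "prime_power_products A E = (\<lambda>f. \<Prod>p\<in>A. p ^ f p) ` (A \<rightarrow>\<^sub>E {..E})"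

lemma finite_prime_power_products: "finite A \<Longrightarrow> finite (prime_power_products A E)"
  unfolding prime_power_products_def by (intro finite_imageI finite_PiE) auto

text \<open>Unique factorization makes the map from exponent vectors to integers injective, so
  expanding the product of the truncated geometric sums yields every \<open>k\<close> exactly
  once.\<close>

lemma sum_prime_power_products:
  fixes g :: "nat \<Rightarrow> real"
  assumes "finite A" "\<And>p. p \<in> A \<Longrightarrow> prime p"
    and one: "g 1 = 1" and mult: "\<And>a b. a > 0 \<Longrightarrow> b > 0 \<Longrightarrow> g (a * b) = g a * g b"
  shows "(\<Sum>k\<in>prime_power_products A E. g k) = (\<Prod>p\<in>A. \<Sum>e\<le>E. g p ^ e)"
proof -
  let ?F = "\<lambda>f::nat\<Rightarrow>nat. \<Prod>p\<in>A. p ^ f p"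
  have inj: "inj_on ?F (A \<rightarrow>\<^sub>E {..E})"
  proof (rule inj_onI)
    fix f h assume f: "f \<in> A \<rightarrow>\<^sub>E {..E}" and h: "h \<in> A \<rightarrow>\<^sub>E {..E}" and eq: "?F f = ?F h"
    show "f = h"
    proof (rule PiE_ext[OF f h])
      fix p assume p: "p \<in> A"
      have "multiplicity p (?F f) = f p" "multiplicity p (?F h) = h p"
        using assms(1,2) p by (simp_all add: multiplicity_prod_prime_powers)
      thus "f p = h p" using eq by simp
    qed
  qed
  have pow: "g (p ^ e) = g p ^ e" if "p > 0" for p e
    using that by (induction e) (auto simp: one[simplified] mult)
  have gF: "g (\<Prod>p\<in>B. p ^ f p) = (\<Prod>p\<in>B. g p ^ f p)" if "finite B" "\<And>p. p \<in> B \<Longrightarrow> prime p" for B f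
    using that
    by (induction B rule: finite_induct) (auto simp: one[simplified] mult pow prime_gt_0_nat intro!: prod_pos)
  have "(\<Sum>k\<in>prime_power_products A E. g k) = (\<Sum>f\<in>A \<rightarrow>\<^sub>E {..E}. g (?F f))"
    unfolding prime_power_products_def by (simp add: sum.reindex[OF inj])
  also have "\<dots> = (\<Sum>f\<in>A \<rightarrow>\<^sub>E {..E}. \<Prod>p\<in>A. g p ^ f p)"
    using gF[OF assms(1,2)] by simp
  also have "\<dots> = (\<Prod>p\<in>A. \<Sum>e\<le>E. g p ^ e)"
    using assms(1) by (subst prod_sum_PiE) auto
  finally show ?thesis .
qed

lemma atLeastAtMost_subset_prime_power_products: "{1..n} \<subseteq> prime_power_products (primes_upto n) n"
proof
  fix m assume m: "m \<in> {1..n}"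
  let ?f = "restrict (\<lambda>p. multiplicity p m) (primes_upto n)"
  have "multiplicity p m \<le> n" if "p \<in> primes_upto n" for p
  proof -
    have "multiplicity p m < p ^ multiplicity p m" using primes_upto_ge_2[OF that]
      by (intro power_gt_expt) auto
    also have "\<dots> \<le> m" using m by (intro dvd_imp_le multiplicity_dvd) auto
    finally show ?thesis using m by simp
  qed
  hence "?f \<in> primes_upto n \<rightarrow>\<^sub>E {..n}" by auto
  moreover have "m = (\<Prod>p\<in>primes_upto n. p ^ ?f p)"
    using nat_eq_prod_primes_upto[of m n] m by simp
  ultimately show "m \<in> prime_power_products (primes_upto n) n"
    unfolding prime_power_products_def by blast
qed

lemma sum_powr_le_euler_product:
  assumes "s > 0"
  shows "(\<Sum>k=1..n. real k powr -s) \<le> (\<Prod>p\<in>primes_upto n. 1 / (1 - real p powr -s))"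
proof -
  let ?g = "\<lambda>k::nat. real k powr -s"
  have "(\<Sum>k=1..n. ?g k) \<le> (\<Sum>k\<in>prime_power_products (primes_upto n) n. ?g k)"
    by (intro sum_mono2 finite_prime_power_products atLeastAtMost_subset_prime_power_products) auto
  also have "\<dots> = (\<Prod>p\<in>primes_upto n. \<Sum>e\<le>n. ?g p ^ e)"
    by (intro sum_prime_power_products) (auto simp: powr_mult primes_upto_def)
  also have "\<dots> \<le> (\<Prod>p\<in>primes_upto n. 1 / (1 - ?g p))"
  proof (intro prod_mono conjI sum_nonneg)
    fix p assume p: "p \<in> primes_upto n"
    have "?g p < 1 powr -s" using primes_upto_ge_2[OF p] assms by (intro powr_less_mono2_neg) auto
    hence lt: "?g p < 1" by simp
    have "(\<Sum>e\<le>n. ?g p ^ e) = (1 - ?g p ^ Suc n) / (1 - ?g p)"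
      using lt by (subst sum_gp0) auto
    also have "\<dots> \<le> 1 / (1 - ?g p)" using lt by (intro divide_right_mono) auto
    finally show "(\<Sum>e\<le>n. ?g p ^ e) \<le> 1 / (1 - ?g p)" .
  qed auto
  finally show ?thesis .
qed

subsection \<open>Mertens' third theorem\<close>

text \<open>
  Primes are grouped into the blocks \<open>m < ln p \<le> m + 1\<close>. This turns partial summation
  over primes into summation by parts over integers, with no integrals.
\<close>

definition exp_floor :: "nat \<Rightarrow> nat" where
  "exp_floor m = nat \<lfloor>exp (real m)\<rfloor>"

lemma le_exp_floor_iff: "p > 0 \<Longrightarrow> p \<le> exp_floor m \<longleftrightarrow> ln (real p) \<le> m"
  by (simp add: exp_floor_def le_nat_iff le_floor_iff flip: exp_le_cancel_iff[of "ln p"])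

lemma exp_floor_mono: "m \<le> n \<Longrightarrow> exp_floor m \<le> exp_floor n"
  unfolding exp_floor_def by (intro nat_mono floor_mono) simp

lemma exp_floor_ge_1: "exp_floor m \<ge> 1"
  by (simp add: exp_floor_def le_nat_iff le_floor_iff)

lemma exp_floor_ge: "real (exp_floor m) \<ge> exp m / 2"
proof -
  have "real (exp_floor m) \<ge> exp m - 1" unfolding exp_floor_def by linarith
  thus ?thesis using exp_floor_ge_1[of m] by simp
qed

definition mertens_sum :: "nat \<Rightarrow> real" where
  "mertens_sum m = (\<Sum>p\<in>primes_upto (exp_floor m). ln (real p) / p)"

lemma mertens_sum_0: "mertens_sum 0 = 0"
proof -
  have "primes_upto 1 = {}" by (auto simp: primes_upto_def dest: prime_ge_2_nat)
  thus ?thesis by (simp add: mertens_sum_def exp_floor_def)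
qed

text \<open>\<open>ln (exp_floor m)\<close> differs from \<open>m\<close> by at most
  \<open>ln 2\<close>, so rounding \<open>exp m\<close> to an integer only changes the constant in
  Mertens' first theorem.\<close>

lemma mertens_sum_bound:
  obtains C where "C \<ge> 0" "\<And>m. \<bar>mertens_sum m - m\<bar> \<le> C"
proof -
  obtain C where C: "C \<ge> 0" "\<And>n. n \<ge> 1 \<Longrightarrow> (\<Sum>p\<in>primes_upto n. ln (real p) / p) \<ge> ln n - C"
    using mertens_first_lower by blast
  have "\<bar>mertens_sum m - m\<bar> \<le> C + ln 4" for m
  proof -
    let ?x = "exp_floor m"
    have "ln (exp m / 2) \<le> ln (real ?x)" using exp_floor_ge[of m] exp_floor_ge_1[of m]
      by (subst ln_le_cancel_iff) auto
    hence "m - ln 2 \<le> ln (real ?x)" by (simp add: ln_divide_pos)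
    moreover have "ln (real ?x) \<le> m" using exp_floor_ge_1[of m] le_exp_floor_iff[of ?x m] by simp
    moreover have "ln 2 \<le> ln (4::real)" "ln (2::real) \<ge> 0" by simp_all
    ultimately show ?thesis
      using C(2)[OF exp_floor_ge_1[of m]] mertens_first_upper[OF exp_floor_ge_1[of m]] C(1)
      unfolding mertens_sum_def by linarith
  qed
  thus ?thesis using that[of "C + ln 4"] C(1) by simp
qed

section \<open>Abel summation over prime blocks with a nonnegative decreasing test function\<close>

context
  fixes h :: "real \<Rightarrow> real"
  assumes h_nonneg: "\<And>x. x > 0 \<Longrightarrow> h x \<ge> 0"
    and h_antimono: "\<And>x y. 0 < x \<Longrightarrow> x \<le> y \<Longrightarrow> h y \<le> h x"
begin

text \<open>In the block \<open>m < ln p <= m + 1\<close> the value \<open>h (ln p)\<close> is at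
  least the one at the right end. Evaluating at \<open>m + 1\<close> also covers the first block
  \<open>m = 0\<close>.\<close>

lemma primes_block_lower:
  "(\<Sum>p\<in>primes_upto (exp_floor (Suc m)). ln (real p) / p * h (ln (real p))) \<ge>
   (\<Sum>p\<in>primes_upto (exp_floor m). ln (real p) / p * h (ln (real p))) + (mertens_sum (Suc m) - mertens_sum m) * h (Suc m)"
proof -
  let ?A = "primes_upto (exp_floor m)" and ?B = "primes_upto (exp_floor (Suc m))"
  have sub: "?A \<subseteq> ?B" by (intro primes_upto_mono exp_floor_mono) auto
  have "(mertens_sum (Suc m) - mertens_sum m) * h (Suc m) = (\<Sum>p\<in>?B - ?A. ln (real p) / p * h (Suc m))"
    unfolding mertens_sum_def using sum.subset_diff[OF sub finite_primes_upto, of "\<lambda>p. ln (real p) / p"]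
    by (simp add: sum_distrib_right)
  also have "\<dots> \<le> (\<Sum>p\<in>?B - ?A. ln (real p) / p * h (ln (real p)))"
  proof (intro sum_mono mult_left_mono)
    fix p assume p: "p \<in> ?B - ?A"
    hence p2: "p \<ge> 2" by (auto dest: primes_upto_ge_2)
    moreover have "p \<le> exp_floor (Suc m)" using p by (auto simp: primes_upto_def)
    ultimately have "ln (real p) \<le> Suc m" using le_exp_floor_iff[of p "Suc m"] by simp
    thus "h (Suc m) \<le> h (ln (real p))" using p2 by (intro h_antimono) auto
    show "0 \<le> ln (real p) / p" using p2 by simp
  qed
  finally show ?thesis using sum.subset_diff[OF sub finite_primes_upto, of "\<lambda>p. ln (real p) / p * h (ln (real p))"] by simp
qed

text \<open>Now the left end bounds \<open>h\<close>. It has to be positive, hence the exclusion of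
  \<open>m = 0\<close>.\<close>

lemma primes_block_upper:
  assumes "m \<ge> 1"
  shows "(\<Sum>p\<in>primes_upto (exp_floor (Suc m)). ln (real p) / p * h (ln (real p))) \<le>
   (\<Sum>p\<in>primes_upto (exp_floor m). ln (real p) / p * h (ln (real p))) + (mertens_sum (Suc m) - mertens_sum m) * h m"
proof -
  let ?A = "primes_upto (exp_floor m)" and ?B = "primes_upto (exp_floor (Suc m))"
  have sub: "?A \<subseteq> ?B" by (intro primes_upto_mono exp_floor_mono) auto
  have "(\<Sum>p\<in>?B - ?A. ln (real p) / p * h (ln (real p))) \<le> (\<Sum>p\<in>?B - ?A. ln (real p) / p * h m)"
  proof (intro sum_mono mult_left_mono)
    fix p assume p: "p \<in> ?B - ?A"
    hence p2: "p \<ge> 2" by (auto dest: primes_upto_ge_2)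
    moreover have "\<not> p \<le> exp_floor m" using p by (auto simp: primes_upto_def)
    ultimately have "ln (real p) > m" using le_exp_floor_iff[of p m] by simp
    thus "h (ln (real p)) \<le> h m" using assms by (intro h_antimono) auto
    show "0 \<le> ln (real p) / p" using p2 by simp
  qed
  also have "\<dots> = (mertens_sum (Suc m) - mertens_sum m) * h m"
    unfolding mertens_sum_def using sum.subset_diff[OF sub finite_primes_upto, of "\<lambda>p. ln (real p) / p"]
    by (simp add: sum_distrib_right)
  finally show ?thesis using sum.subset_diff[OF sub finite_primes_upto, of "\<lambda>p. ln (real p) / p * h (ln (real p))"] by simp
qed

text \<open>Abel summation against \<open>mertens_sum m = m + O(C)\<close>: the main term is the sum
  of \<open>h\<close>, and the errors telescope because \<open>h\<close> decreases.\<close>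

lemma primes_sum_lower:
  assumes C: "\<And>m. \<bar>mertens_sum m - m\<bar> \<le> C" and "M \<ge> 1"
  shows "(\<Sum>p\<in>primes_upto (exp_floor M). ln (real p) / p * h (ln (real p))) \<ge> (\<Sum>m=1..M. h (real m)) - C * h 1"
proof -
  \<comment> \<open>The inductive statement keeps the boundary term
    \<open>(mertens_sum M - M) * h M\<close> exact; \<open>C * (h 1 - h M)\<close> is the telescoped
    sum of the errors \<open>C * (h m - h (m + 1))\<close>.\<close>
  have "(\<Sum>p\<in>primes_upto (exp_floor M). ln (real p) / p * h (ln (real p))) \<ge>
        (\<Sum>m=1..M. h (real m)) + (mertens_sum M - M) * h M - C * (h 1 - h M)"
    using \<open>M \<ge> 1\<close>
  proof (induction M rule: nat_induct_at_least)
    case base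
    have "(\<Sum>p\<in>primes_upto (exp_floor 0). ln (real p) / p * h (ln (real p))) = 0"
      by (intro sum.neutral) (auto simp: primes_upto_def exp_floor_def dest: prime_ge_2_nat)
    thus ?case using primes_block_lower[of 0] by (simp add: mertens_sum_0 algebra_simps)
  next
    case (Suc M)
    have "(h M - h (Suc M)) * (mertens_sum M - M) \<ge> (h M - h (Suc M)) * (- C)"
      using Suc.hyps by (intro mult_left_mono) (use C[of M] h_antimono[of M "Suc M"] in auto)
    thus ?case using primes_block_lower[of M] Suc by (simp add: algebra_simps)
  qed
  moreover have "h M * (mertens_sum M - M) \<ge> h M * (- C)"
    using assms(2) h_nonneg[of M] C[of M] by (intro mult_left_mono) (auto simp: abs_le_iff)
  ultimately show ?thesis by (simp add: algebra_simps)
qed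

lemma primes_sum_upper:
  assumes C: "\<And>m. \<bar>mertens_sum m - m\<bar> \<le> C" and M: "M \<ge> 1" and "K \<ge> M"
  shows "(\<Sum>p\<in>primes_upto (exp_floor K) - primes_upto (exp_floor M). ln (real p) / p * h (ln (real p)))
           \<le> (\<Sum>m=M..<K. h (real m)) + 2 * C * h M"
proof -
  \<comment> \<open>Of \<open>C * (2 * h M - h K)\<close>, one \<open>C * h M\<close> pays for the
    boundary term at \<open>M\<close>, and \<open>C * (h M - h K)\<close> is the telescoped
    error.\<close>
  have "(\<Sum>p\<in>primes_upto (exp_floor K). ln (real p) / p * h (ln (real p))) \<le> (\<Sum>p\<in>primes_upto (exp_floor M). ln (real p) / p * h (ln (real p))) +
         (\<Sum>m=M..<K. h (real m)) + (mertens_sum K - K) * h K + C * (2 * h M - h K)"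
    using \<open>K \<ge> M\<close>
  proof (induction K rule: nat_induct_at_least)
    case base
    have "h M * (mertens_sum M - M) \<ge> h M * (- C)"
      using M h_nonneg[of M] C[of M] by (intro mult_left_mono) auto
    thus ?case by (simp add: algebra_simps)
  next
    case (Suc K)
    have "(h K - h (Suc K)) * (mertens_sum (Suc K) - Suc K) \<le> (h K - h (Suc K)) * C"
      using Suc.hyps M by (intro mult_left_mono) (use C[of "Suc K"] h_antimono[of K "Suc K"] in auto)
    thus ?case using primes_block_upper[of K] Suc M by (simp add: algebra_simps)
  qed
  moreover have "h K * (mertens_sum K - K) \<le> h K * C"
    using assms(2,3) h_nonneg[of K] C[of K] by (intro mult_left_mono) (auto simp: abs_le_iff)
  moreover have sub: "primes_upto (exp_floor M) \<subseteq> primes_upto (exp_floor K)"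
    using \<open>K \<ge> M\<close> by (intro primes_upto_mono exp_floor_mono)
  ultimately show ?thesis
    using sum.subset_diff[OF sub finite_primes_upto, of "\<lambda>p. ln (real p) / p * h (ln (real p))"] by (simp add: algebra_simps)
qed

end

section \<open>Analytic inequalities for the third theorem\<close>

text \<open>The derivative has the sign of \<open>(1 + c * t) * exp (- c * t) - 1\<close>, which is
  nonpositive. This makes the function \<open>h1\<close> of the third theorem eligible for the
  summation by parts.\<close>

lemma one_minus_exp_div_antimono:
  fixes c x y :: real
  assumes "c > 0" "0 < x" "x \<le> y"
  shows "(1 - exp (- c * y)) / y \<le> (1 - exp (- c * x)) / x"
proof (rule DERIV_nonpos_imp_nonincreasing[OF assms(3)])
  fix t assume t: "x \<le> t" "t \<le> y"
  have "1 + c * t \<le> exp (c * t)" by (rule exp_ge_add_one_self)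
  hence "(1 + c * t) * exp (- c * t) \<le> exp (c * t) * exp (- c * t)" by (intro mult_right_mono) auto
  hence "(1 + c * t) * exp (- c * t) \<le> 1" by (simp add: exp_minus field_simps)
  hence "(c * exp (- c * t) * t - (1 - exp (- c * t)) * 1) / (t * t) \<le> 0"
    using t assms by (intro divide_nonpos_nonneg) (auto simp: algebra_simps)
  moreover have "((\<lambda>t. (1 - exp (- c * t)) / t) has_real_derivative
      (c * exp (- c * t) * t - (1 - exp (- c * t)) * 1) / (t * t)) (at t)"
    using t assms by (auto intro!: derivative_eq_intros)
  ultimately show "\<exists>d. ((\<lambda>t. (1 - exp (- c * t)) / t) has_real_derivative d) (at t) \<and> d \<le> 0" by blast
qed

lemma sum_power_div_le:
  fixes y :: real
  assumes "0 \<le> y" "y < 1"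
  shows "(\<Sum>m=1..K. y ^ m / m) \<le> - ln (1 - y)"
proof -
  have "(\<lambda>n. - ((- (- y)) ^ n) / of_nat n) sums ln (1 + (- y))"
    using assms by (intro ln_series') auto
  from sums_minus[OF this] have "(\<lambda>n. y ^ n / n) sums (- ln (1 - y))" by simp
  hence "(\<Sum>m\<in>{1..K}. y ^ m / m) \<le> - ln (1 - y)"
    using assms by (metis (no_types, lifting) sums_iff sum_le_suminf finite_atLeastAtMost divide_nonneg_nonneg of_nat_0_le_iff zero_le_power)
  thus ?thesis .
qed

lemma harm_ge_ln_add_euler_mascheroni:
  assumes "M \<ge> 1"
  shows "harm M \<ge> ln (real M) + euler_mascheroni"
proof -
  have "euler_mascheroni \<le> harm M - ln (real M)"
  proof (rule LIMSEQ_le_const2[OF euler_mascheroni_LIMSEQ])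
    have "harm n - ln (real n) \<le> harm M - ln (real M)" if "n \<ge> M" for n
      using that assms
    proof (induction n rule: nat_induct_at_least)
      case (Suc n)
      thus ?case using euler_mascheroni_sequence_decreasing[of n "Suc n"] by simp
    qed auto
    thus "\<exists>N. \<forall>n\<ge>N. harm n - ln (real n) \<le> harm M - ln (real M)" by blast
  qed
  thus ?thesis by simp
qed

text \<open>A finite form of the bound that the zeta function at \<open>1 + \<epsilon>\<close> is at
  least \<open>1 / \<epsilon>\<close>. The right side telescopes into differences of
  \<open>k powr -\<epsilon>\<close>, each at most
  \<open>\<epsilon> * k powr -(1 + \<epsilon>)\<close>.\<close>

lemma sum_powr_ge:
  fixes \<epsilon> :: real
  assumes "\<epsilon> > 0"
  shows "\<epsilon> * (\<Sum>k=1..n. real k powr -(1 + \<epsilon>)) \<ge> 1 - (real n + 1) powr -\<epsilon>"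
proof -
  have "1 - (real n + 1) powr -\<epsilon> = (\<Sum>k=1..n. real k powr -\<epsilon> - real (Suc k) powr -\<epsilon>)"
    using sum_Suc_diff'[of 1 "Suc n" "\<lambda>k. - (real k powr -\<epsilon>)"]
    by (simp add: atLeastLessThanSuc_atLeastAtMost add.commute)
  also have "\<dots> \<le> (\<Sum>k=1..n. \<epsilon> * real k powr -(1 + \<epsilon>))"
  proof (intro sum_mono)
    fix k assume k: "k \<in> {1..n}"
    have "1 - \<epsilon> / k \<le> 1 - \<epsilon> * ln (1 + 1 / k)"
      using ln_add_one_self_le_self[of "1 / k"] assms k
      by (simp add: divide_inverse mult_left_mono)
    also have "\<dots> \<le> exp (- \<epsilon> * ln (1 + 1 / k))"
      using exp_ge_add_one_self[of "- \<epsilon> * ln (1 + 1 / k)"] by simp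
    also have "\<dots> = (1 + 1 / k) powr -\<epsilon>" using k by (simp add: powr_def add_pos_nonneg[THEN less_imp_neq, symmetric])
    finally have "real k powr -\<epsilon> * (1 - \<epsilon> / k) \<le> real k powr -\<epsilon> * (1 + 1 / k) powr -\<epsilon>"
      by (intro mult_left_mono) auto
    also have "\<dots> = (k * (1 + 1 / k)) powr -\<epsilon>" using k by (simp add: powr_mult)
    also have "k * (1 + 1 / k) = real (Suc k)" using k by (simp add: field_simps)
    finally have "real k powr -\<epsilon> - real (Suc k) powr -\<epsilon> \<le> \<epsilon> * (real k powr -\<epsilon> / k)"
      by (simp add: algebra_simps)
    also have "real k powr -\<epsilon> / k = real k powr (-\<epsilon> - 1)" using k by (subst powr_diff) auto
    also have "-\<epsilon> - 1 = -(1 + \<epsilon>)" by simp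
    finally show "real k powr -\<epsilon> - real (Suc k) powr -\<epsilon> \<le> \<epsilon> * real k powr -(1 + \<epsilon>)" .
  qed
  finally show ?thesis by (simp add: sum_distrib_left)
qed

lemma sum_inverse_squares_le: "X \<ge> 1 \<Longrightarrow> (\<Sum>n=Suc X..Y. 1 / real n ^ 2) \<le> 1 / X"
proof -
  assume X: "X \<ge> 1"
  have "(\<Sum>n=Suc X..Y. 1 / real n ^ 2) \<le> 1 / X - 1 / Y" if "Y \<ge> X" 
    using that
  proof (induction Y rule: nat_induct_at_least)
    case (Suc Y)
    have "1 / real (Suc Y) ^ 2 \<le> 1 / Y - 1 / real (Suc Y)"
    proof -
      have "1 / real (Suc Y) ^ 2 \<le> 1 / (Y * real (Suc Y))"
        using Suc.hyps X by (intro divide_left_mono) (auto simp: power2_eq_square intro!: mult_right_mono)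
      also have "\<dots> = 1 / Y - 1 / real (Suc Y)" using Suc.hyps X by (simp add: field_simps)
      finally show ?thesis .
    qed
    thus ?case using Suc by simp
  qed auto
  moreover have "1 / X - 1 / Y \<le> 1 / real X" by simp
  ultimately show ?thesis by (cases "Y \<ge> X") (blast intro: order_trans, simp)
qed

lemma neg_ln_one_minus_le:
  fixes b :: real
  assumes "0 \<le> b" "b \<le> 1 / 2"
  shows "- ln (1 - b) \<le> b + 2 * b ^ 2"
proof -
  have "- ln (1 - b) = ln (1 / (1 - b))" using assms by (simp add: ln_div)
  also have "\<dots> \<le> 1 / (1 - b) - 1" using assms by (intro ln_le_minus_one) auto
  also have "\<dots> = b / (1 - b)" using assms by (simp add: field_simps)
  also have "\<dots> \<le> b + 2 * b ^ 2"
  proof -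
    have "b * (b * (1 - 2 * b)) \<ge> 0" using assms by simp
    thus ?thesis using assms by (simp add: field_simps power2_eq_square)
  qed
  finally show ?thesis .
qed

text \<open>Apply \<open>ln u <= u - 1\<close> to \<open>u = (1 - a) / (1 - b)\<close>. The sign is
  favourable, so the primes up to \<open>exp M\<close> cause no quadratic error term.\<close>

lemma ln_one_minus_diff_ge:
  fixes a b :: real
  assumes "0 \<le> b" "b \<le> a" "a < 1"
  shows "ln (1 - b) - ln (1 - a) \<ge> a - b"
proof -
  have "ln ((1 - a) / (1 - b)) \<le> (1 - a) / (1 - b) - 1" using assms by (intro ln_le_minus_one) auto
  also have "\<dots> = - ((a - b) / (1 - b))" using assms by (simp add: field_simps)
  finally have "(a - b) / (1 - b) \<le> ln (1 - b) - ln (1 - a)"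
    using assms by (simp add: ln_divide_pos)
  moreover have "(a - b) / (1 - b) \<ge> a - b"
    using assms mult_left_mono[of "1 - b" 1 "a - b"] by (simp add: pos_le_divide_eq)
  ultimately show ?thesis by linarith
qed

text \<open>
  The product over \<open>p \<le> exp M\<close> is compared with the zeta function at \<open>1 + 1 / M\<close>. By partial
  summation the difference of the logarithms is, up to \<open>O(1 / M)\<close>, equal to
  \<open>harm M - (\<Sum>m. exp (- m / M) / m) = harm M + ln (1 - exp (- 1 / M))\<close>, which tends to \<open>\<gamma>\<close>.
\<close>

lemma mertens_third_exp_floor:
  assumes C: "\<And>m. \<bar>mertens_sum m - m\<bar> \<le> C" and M: "M \<ge> 1"
  shows "ln M + euler_mascheroni - (3 * C + 6) / M \<le> (\<Sum>p\<in>primes_upto (exp_floor M). - ln (1 - 1 / p))"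
proof -
  define \<epsilon> where "\<epsilon> = 1 / real M"
  \<comment> \<open>Weighted by \<open>ln p / p\<close>, the value \<open>h1 (ln p)\<close> gives
    \<open>1 / p - b p\<close> and \<open>h2 (ln p)\<close> gives \<open>b p\<close>, where
    \<open>b p = p powr -(1 + 1 / M)\<close>.\<close>
  define h1 where "h1 = (\<lambda>v::real. (1 - exp (- \<epsilon> * v)) / v)"
  define h2 where "h2 = (\<lambda>v::real. exp (- \<epsilon> * v) / v)"
  define b where "b = (\<lambda>p::nat. real p powr -(1 + \<epsilon>))"
  define X where "X = exp_floor M"
  define L where "L = (\<Sum>p\<in>primes_upto X. - ln (1 - 1 / p))"
  have eps: "\<epsilon> > 0" using M by (simp add: \<epsilon>_def)
  have C0: "C \<ge> 0" using C[of 0] by linarith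
  have b_eq: "b p = exp (- \<epsilon> * ln p) / p" if "p \<ge> 2" for p
    using that by (simp add: b_def powr_def exp_diff ring_distribs exp_minus field_simps exp_add)
  have b_le: "b p \<le> 1 / p" if "p \<ge> 2" for p
    using that eps by (subst b_eq) (auto intro!: divide_right_mono)
  have b_ge: "b p \<ge> 0" for p by (simp add: b_def)
  have half: "1 / real p \<le> 1 / 2" if "p \<ge> 2" for p using that by (simp add: field_simps)
  have h1_1: "h1 1 \<le> 1 / M"
    using exp_ge_add_one_self[of "- \<epsilon>"] by (simp add: h1_def \<epsilon>_def)
  have h2_M: "h2 M \<le> 1 / M" using M eps by (auto simp: h2_def intro!: divide_right_mono)

  have near: "L + (\<Sum>p\<in>primes_upto X. ln (1 - b p)) \<ge> (\<Sum>m=1..M. h1 (real m)) - C / M"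
  proof -
    have "(\<Sum>m=1..M. h1 (real m)) - C * h1 1 \<le> (\<Sum>p\<in>primes_upto X. ln (real p) / p * h1 (ln (real p)))"
      unfolding X_def
    proof (rule primes_sum_lower[OF _ _ C M])
      show "h1 x \<ge> 0" if "x > 0" for x using that eps by (simp add: h1_def)
      show "h1 y \<le> h1 x" if "0 < x" "x \<le> y" for x y
        unfolding h1_def using one_minus_exp_div_antimono[OF eps that] .
    qed
    also have "\<dots> \<le> (\<Sum>p\<in>primes_upto X. ln (1 - b p) - ln (1 - 1 / p))"
    proof (intro sum_mono)
      fix p assume "p \<in> primes_upto X"
      note p = primes_upto_ge_2[OF this]
      have "ln (real p) / p * h1 (ln (real p)) = 1 / p - b p"
        using p by (simp add: h1_def b_eq field_simps)
      also have "\<dots> \<le> ln (1 - b p) - ln (1 - 1 / p)"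
        using b_ge b_le[OF p] p by (intro ln_one_minus_diff_ge) auto
      finally show "ln (real p) / p * h1 (ln (real p)) \<le> ln (1 - b p) - ln (1 - 1 / p)" .
    qed
    also have "\<dots> = L + (\<Sum>p\<in>primes_upto X. ln (1 - b p))"
      by (simp add: L_def sum_subtractf sum_negf)
    finally show ?thesis using mult_left_mono[OF h1_1 C0] by simp
  qed

  \<comment> \<open>The zeta function at \<open>1 + \<epsilon>\<close> is replaced by its partial
    sum up to \<open>exp K\<close>, with \<open>K\<close> tending to infinity at the end.\<close>
  have main: "ln (\<Sum>k=1..exp_floor K. b k) + euler_mascheroni - (3 * C + 6) / M \<le> L"
    if K: "K \<ge> M" for K
  proof -
    define Y where "Y = exp_floor K"
    have sub: "primes_upto X \<subseteq> primes_upto Y" unfolding X_def Y_def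
      using K by (intro primes_upto_mono exp_floor_mono)
    \<comment> \<open>The primes between \<open>exp M\<close> and \<open>exp K\<close> occur only in
      the Euler product at \<open>1 + \<epsilon>\<close>. Their contribution is bounded above, the
      quadratic terms giving \<open>4 / M\<close>.\<close>
    have far: "- (\<Sum>p\<in>primes_upto Y - primes_upto X. ln (1 - b p)) \<le> (\<Sum>m=M..<K. h2 (real m)) + 2 * C / M + 4 / M"
    proof -
      have "- (\<Sum>p\<in>primes_upto Y - primes_upto X. ln (1 - b p))
          \<le> (\<Sum>p\<in>primes_upto Y - primes_upto X. ln (real p) / p * h2 (ln (real p)) + 2 * (1 / real p ^ 2))"
        unfolding sum_negf[symmetric]
      proof (intro sum_mono)
        fix p assume "p \<in> primes_upto Y - primes_upto X"
        hence p: "p \<ge> 2" by (auto dest: primes_upto_ge_2)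
        have "- ln (1 - b p) \<le> b p + 2 * b p ^ 2"
          using b_ge b_le[OF p] half[OF p] by (intro neg_ln_one_minus_le) (auto intro: order_trans)
        also have "b p ^ 2 \<le> (1 / p) ^ 2" using b_ge b_le[OF p] by (intro power_mono)
        finally have "- ln (1 - b p) \<le> b p + 2 * (1 / p) ^ 2" by simp
        moreover have "b p = ln (real p) / p * h2 (ln (real p))" using p by (simp add: h2_def b_eq)
        ultimately show "- ln (1 - b p) \<le> ln (real p) / p * h2 (ln (real p)) + 2 * (1 / real p ^ 2)"
          by (simp add: power_divide)
      qed
      also have "\<dots> = (\<Sum>p\<in>primes_upto Y - primes_upto X. ln (real p) / p * h2 (ln (real p)))
            + 2 * (\<Sum>p\<in>primes_upto Y - primes_upto X. 1 / real p ^ 2)"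
        by (simp add: sum.distrib sum_distrib_left)
      also have "(\<Sum>p\<in>primes_upto Y - primes_upto X. ln (real p) / p * h2 (ln (real p)))
          \<le> (\<Sum>m=M..<K. h2 (real m)) + 2 * C * h2 M" unfolding X_def Y_def
      proof (rule primes_sum_upper[OF _ _ C M K])
        show "h2 x \<ge> 0" if "x > 0" for x using that by (simp add: h2_def)
        show "h2 y \<le> h2 x" if "0 < x" "x \<le> y" for x y
          unfolding h2_def using that eps by (intro frac_le) auto
      qed
      also have "2 * C * h2 M \<le> 2 * C * (1 / M)" using C0 h2_M by (intro mult_left_mono) auto
      also have "(\<Sum>p\<in>primes_upto Y - primes_upto X. 1 / real p ^ 2) \<le> (\<Sum>n=Suc X..Y. 1 / real n ^ 2)"
        by (intro sum_mono2) (auto simp: primes_upto_def)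
      also have "\<dots> \<le> 1 / X" unfolding X_def by (intro sum_inverse_squares_le exp_floor_ge_1)
      also have "1 / real X \<le> 2 / M"
      proof -
        have "real M / 2 \<le> exp M / 2" using exp_ge_add_one_self[of "real M"] by linarith
        hence "M / 2 \<le> real X" unfolding X_def using exp_floor_ge[of M] by linarith
        moreover have "X > 0" using exp_floor_ge_1[of M] by (simp add: X_def)
        ultimately show ?thesis using M by (simp add: field_simps)
      qed
      finally show ?thesis by simp
    qed
    have "ln (\<Sum>k=1..Y. b k) \<le> ln (\<Prod>p\<in>primes_upto Y. 1 / (1 - b p))"
    proof (subst ln_le_cancel_iff)
      show le: "(\<Sum>k=1..Y. b k) \<le> (\<Prod>p\<in>primes_upto Y. 1 / (1 - b p))"
        unfolding b_def using eps by (intro sum_powr_le_euler_product) auto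
      show pos: "(\<Sum>k=1..Y. b k) > 0"
        using exp_floor_ge_1[of K] by (intro sum_pos) (auto simp: b_def Y_def)
      show "(\<Prod>p\<in>primes_upto Y. 1 / (1 - b p)) > 0" using le pos by linarith
    qed
    also have "\<dots> = (\<Sum>p\<in>primes_upto Y. - ln (1 - b p))"
    proof (subst ln_prod)
      have "1 - b p > 0" if "p \<in> primes_upto Y" for p
        using b_le[of p] half[of p] primes_upto_ge_2[OF that] by linarith
      thus "\<And>p. p \<in> primes_upto Y \<Longrightarrow> 1 / (1 - b p) \<noteq> 0" 
        "(\<Sum>p\<in>primes_upto Y. ln (1 / (1 - b p))) = (\<Sum>p\<in>primes_upto Y. - ln (1 - b p))"
        by (force, auto simp: ln_div intro!: sum.cong)
    qed auto
    also have "\<dots> = - (\<Sum>p\<in>primes_upto Y - primes_upto X. ln (1 - b p)) - (\<Sum>p\<in>primes_upto X. ln (1 - b p))"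
      using sum.subset_diff[OF sub finite_primes_upto, of "\<lambda>p. - ln (1 - b p)"] by (simp add: sum_negf)
    finally have euler: "ln (\<Sum>k=1..Y. b k) \<le> \<dots>" .

    define y where "y = exp (- \<epsilon>)"
    have y: "0 < y" "y < 1" using eps by (auto simp: y_def)
    have y_pow: "exp (- (\<epsilon> * real m)) = y ^ m" for m
      unfolding y_def by (simp add: exp_of_nat_mult[symmetric] mult.commute)
    \<comment> \<open>Both sums run through parts of the series for \<open>- ln (1 - y)\<close>; the
      index \<open>m = M\<close> occurs twice, hence the extra \<open>y ^ M / M\<close>.\<close>
    have "(\<Sum>m=1..M. y ^ m / m) + (\<Sum>m=M..<K. y ^ m / m) \<le> (\<Sum>m=1..K. y ^ m / m) + y ^ M / M"
    proof -
      have "{1..K} = {1..M} \<union> {M<..K}" using K M by auto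
      hence "(\<Sum>m=1..K. y ^ m / m) = (\<Sum>m=1..M. y ^ m / m) + (\<Sum>m\<in>{M<..K}. y ^ m / m)"
        by (metis sum.union_disjoint finite_atLeastAtMost finite_greaterThanAtMost ivl_disj_int_two(8))
      moreover have "(\<Sum>m=M..<K. y ^ m / m) \<le> (\<Sum>m\<in>insert M {M<..K}. y ^ m / m)"
        using y by (intro sum_mono2) auto
      ultimately show ?thesis by simp
    qed
    also have "\<dots> \<le> (ln M + 1 / M) + 1 / M"
    proof (rule add_mono)
      have "(\<Sum>m=1..K. y ^ m / m) \<le> - ln (1 - y)" using y by (intro sum_power_div_le) auto
      also have "\<epsilon> * y \<le> 1 - y"
      proof -
        have "(1 + \<epsilon>) * y \<le> exp \<epsilon> * y" using y exp_ge_add_one_self[of \<epsilon>] by (intro mult_right_mono) auto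
        also have "\<dots> = 1" by (simp add: y_def exp_minus)
        finally show ?thesis by (simp add: algebra_simps)
      qed
      hence "ln (\<epsilon> * y) \<le> ln (1 - y)" using y eps by (subst ln_le_cancel_iff) auto
      hence "- ln (1 - y) \<le> ln M + 1 / M" using M by (simp add: ln_mult y_def \<epsilon>_def ln_div)
      finally show "(\<Sum>m=1..K. y ^ m / m) \<le> ln M + 1 / M" .
      show "y ^ M / M \<le> 1 / M" using y M by (intro divide_right_mono power_le_one) auto
    qed
    finally have "(\<Sum>m=1..M. y ^ m / m) + (\<Sum>m=M..<K. y ^ m / m) \<le> ln M + 2 / M" by simp
    moreover have "(\<Sum>m=1..M. h1 (real m)) = harm M - (\<Sum>m=1..M. y ^ m / m)"
      by (simp add: h1_def y_pow harm_def diff_divide_distrib sum_subtractf inverse_eq_divide)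
    moreover have "(\<Sum>m=M..<K. h2 (real m)) = (\<Sum>m=M..<K. y ^ m / m)"
      by (simp add: h2_def y_pow)
    \<comment> \<open>The error is \<open>C\<close> from the primes up to \<open>exp M\<close>,
      \<open>2 * C + 4\<close> from those beyond, and 2 from the power series, each divided by
      \<open>M\<close>.\<close>
    moreover have "(3 * C + 6) / M = C / M + 2 * C / M + 4 / M + 2 / M"
      by (simp add: add_divide_distrib)
    ultimately show ?thesis
      using near far euler harm_ge_ln_add_euler_mascheroni[OF M] unfolding Y_def by linarith
  qed

  \<comment> \<open>\<open>sum_powr_ge\<close> bounds the partial sum from below by
    \<open>M * (1 - exp (- \<epsilon> * K))\<close>, which tends to \<open>M\<close> as
    \<open>K\<close> grows.\<close>
  have "ln (M * (1 - exp (- \<epsilon> * K))) + euler_mascheroni - (3 * C + 6) / M \<le> L" if K: "K \<ge> M" for K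
  proof -
    have "(real (exp_floor K) + 1) powr -\<epsilon> \<le> exp K powr -\<epsilon>"
      using eps by (intro powr_mono2') (auto simp: exp_floor_def intro!: less_imp_le real_of_int_floor_add_one_gt)
    moreover have "exp K powr -\<epsilon> = exp (- \<epsilon> * K)" by (simp add: powr_def)
    ultimately have "1 - exp (- \<epsilon> * K) \<le> \<epsilon> * (\<Sum>k=1..exp_floor K. b k)"
      using sum_powr_ge[OF eps, of "exp_floor K"] unfolding b_def by linarith
    hence "M * (1 - exp (- \<epsilon> * K)) \<le> (\<Sum>k=1..exp_floor K. b k)" using M by (simp add: \<epsilon>_def field_simps)
    moreover have "M * (1 - exp (- \<epsilon> * K)) > 0" using K M eps by simp
    ultimately have "ln (M * (1 - exp (- \<epsilon> * K))) \<le> ln (\<Sum>k=1..exp_floor K. b k)"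
      by (subst ln_le_cancel_iff) auto
    thus ?thesis using main[OF K] by linarith
  qed
  moreover have "(\<lambda>K. ln (M * (1 - exp (- \<epsilon> * real K))) + euler_mascheroni - (3 * C + 6) / M)
      \<longlonglongrightarrow> ln (real M * (1 - 0)) + euler_mascheroni - (3 * C + 6) / M"
  proof -
    have lim: "(\<lambda>K. exp (- \<epsilon> * real K)) \<longlonglongrightarrow> 0" using eps by real_asymp
    have "(\<lambda>K. M * (1 - exp (- \<epsilon> * real K))) \<longlonglongrightarrow> real M * (1 - 0)"
      by (intro tendsto_mult tendsto_diff tendsto_const lim)
    thus ?thesis
      by (intro tendsto_diff[OF tendsto_add[OF tendsto_ln]] tendsto_const) (use M in auto)
  qed
  ultimately have "ln (real M * (1 - 0)) + euler_mascheroni - (3 * C + 6) / M \<le> L"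
    by (intro LIMSEQ_le_const2) blast+
  thus ?thesis by (simp add: L_def X_def)
qed

text \<open>Rounding \<open>ln n\<close> down to an integer \<open>M\<close> costs 1, and
  \<open>exp (- C' / M) >= 1 - C' / M\<close> turns the relative error \<open>O(1 / M)\<close> into
  the additive error \<open>C'\<close>. For \<open>M = 0\<close> the lower bound is not
  positive.\<close>

theorem mertens_third_lower:
  obtains C where "C \<ge> 0"
    "\<And>n. n \<ge> 2 \<Longrightarrow> (\<Prod>p\<in>primes_upto n. 1 / (1 - 1 / real p)) \<ge> exp euler_mascheroni * (ln n - C)"
proof -
  obtain C where C: "C \<ge> 0" "\<And>m. \<bar>mertens_sum m - m\<bar> \<le> C" using mertens_sum_bound by blast
  define C' where "C' = 3 * C + 6"
  show ?thesis
  proof (rule that[of "C' + 1"])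
    show "C' + 1 \<ge> 0" using C by (simp add: C'_def)
    fix n :: nat assume n: "n \<ge> 2"
    let ?P = "\<lambda>n. \<Prod>p\<in>primes_upto n. 1 / (1 - 1 / real p)"
    have factor: "1 / (1 - 1 / real p) \<ge> 1" if "p \<in> primes_upto n" for p n
      using primes_upto_ge_2[OF that] by (simp add: field_simps)
    define M where "M = nat \<lfloor>ln n\<rfloor>"
    show "?P n \<ge> exp euler_mascheroni * (ln n - (C' + 1))"
    proof (cases "M \<ge> 1")
      case False
      hence "ln n < 1" unfolding M_def by linarith
      hence "exp euler_mascheroni * (ln n - (C' + 1)) \<le> 0"
        using C by (intro mult_nonneg_nonpos) (auto simp: C'_def)
      also have "0 \<le> ?P n" using factor by (intro prod_nonneg) (meson order_trans zero_le_one)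
      finally show ?thesis .
    next
      case True
      have M_le: "real M \<le> ln n" and M_ge: "real M \<ge> ln n - 1" using True unfolding M_def by linarith+
      have pos: "1 - 1 / real p > 0" if "p \<in> primes_upto n" for p n
        using primes_upto_ge_2[OF that] by simp
      have "exp euler_mascheroni * (ln n - (C' + 1)) \<le> exp euler_mascheroni * (M - C')"
        using M_ge by (intro mult_left_mono) auto
      also have "\<dots> = exp euler_mascheroni * (M * (1 - C' / M))" using True by (simp add: field_simps)
      also have "\<dots> \<le> exp euler_mascheroni * (M * exp (- C' / M))"
        using exp_ge_add_one_self[of "- C' / M"] by (intro mult_left_mono) auto
      also have "\<dots> = exp (ln M + euler_mascheroni - C' / M)" using True by (simp add: exp_add exp_diff exp_minus divide_inverse)
      also have "\<dots> \<le> exp (\<Sum>p\<in>primes_upto (exp_floor M). - ln (1 - 1 / p))"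
        using mertens_third_exp_floor[OF C(2) True] by (simp add: C'_def)
      also have "\<dots> = ?P (exp_floor M)"
        using pos by (simp add: exp_sum exp_minus inverse_eq_divide cong: prod.cong)
      also have "\<dots> \<le> ?P n"
      proof (rule prod_mono2)
        have "ln (real (exp_floor M)) \<le> M" using le_exp_floor_iff[of "exp_floor M" M] exp_floor_ge_1[of M] by simp
        hence "ln (real (exp_floor M)) \<le> ln n" using M_le by linarith
        hence "exp_floor M \<le> n" using n exp_floor_ge_1[of M] by (subst (asm) ln_le_cancel_iff) auto
        thus "primes_upto (exp_floor M) \<subseteq> primes_upto n" by (rule primes_upto_mono)
        show "0 \<le> 1 / (1 - 1 / real p)" if "p \<in> primes_upto (exp_floor M)" for p
          using factor[OF that] by linarith
      qed (use factor in auto)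
      finally show ?thesis .
    qed
  qed
qed

subsection \<open>Almost periodic functions with nonnegative coefficients\<close>

text \<open>A trigonometric sum is encoded by the list of its pairs (coefficient, frequency).\<close>

definition trig_sum :: "(real \<times> real) list \<Rightarrow> real \<Rightarrow> complex" where
  "trig_sum xs t = (\<Sum>(c, l)\<leftarrow>xs. of_real c * cis (l * t))"

lemma trig_sum_Nil [simp]: "trig_sum [] t = 0"
  by (simp add: trig_sum_def)

lemma trig_sum_Cons [simp]: "trig_sum ((c, l) # xs) t = of_real c * cis (l * t) + trig_sum xs t"
  by (simp add: trig_sum_def)

lemma trig_sum_append [simp]: "trig_sum (xs @ ys) t = trig_sum xs t + trig_sum ys t"
  by (simp add: trig_sum_def)

text \<open>Nonnegativity of the coefficients is expressed through uniform approximation by finite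
  sums. Thus infinite series are covered too, and the property passes to sums, products and
  conjugates.\<close>

definition positive_ap :: "(real \<Rightarrow> complex) \<Rightarrow> bool" where
  "positive_ap f \<longleftrightarrow> (\<forall>e>0. \<exists>xs. (\<forall>(c, l)\<in>set xs. c \<ge> 0) \<and>
     (\<forall>t. norm (f t - trig_sum xs t) \<le> e))"

lemma positive_apE:
  assumes "positive_ap f" "e > 0"
  obtains xs where "\<forall>(c, l)\<in>set xs. c \<ge> 0" "\<And>t. norm (f t - trig_sum xs t) \<le> e"
  using assms unfolding positive_ap_def by blast

lemma positive_ap_cis: "c \<ge> 0 \<Longrightarrow> positive_ap (\<lambda>t. of_real c * cis (l * t))"
  unfolding positive_ap_def by (intro allI impI exI[of _ "[(c, l)]"]) (auto simp: trig_sum_def)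

lemma positive_ap_const: "c \<ge> 0 \<Longrightarrow> positive_ap (\<lambda>t. of_real c)"
  using positive_ap_cis[of c 0] by simp

lemma positive_ap_add:
  assumes "positive_ap f" "positive_ap g"
  shows "positive_ap (\<lambda>t. f t + g t)"
  unfolding positive_ap_def
proof (intro allI impI)
  fix e :: real assume e: "e > 0"
  obtain xs where xs: "\<forall>(c, l)\<in>set xs. c \<ge> 0" "\<And>t. norm (f t - trig_sum xs t) \<le> e / 2"
    using positive_apE[OF assms(1), of "e / 2"] e by auto
  obtain ys where ys: "\<forall>(c, l)\<in>set ys. c \<ge> 0" "\<And>t. norm (g t - trig_sum ys t) \<le> e / 2"
    using positive_apE[OF assms(2), of "e / 2"] e by auto
  show "\<exists>zs. (\<forall>(c, l)\<in>set zs. c \<ge> 0) \<and> (\<forall>t. norm (f t + g t - trig_sum zs t) \<le> e)"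
  proof (intro exI[of _ "xs @ ys"] conjI allI)
    fix t
    have "norm (f t + g t - trig_sum (xs @ ys) t) = norm ((f t - trig_sum xs t) + (g t - trig_sum ys t))"
      by (simp add: algebra_simps)
    also have "\<dots> \<le> e / 2 + e / 2" by (rule norm_triangle_mono[OF xs(2) ys(2)])
    finally show "norm (f t + g t - trig_sum (xs @ ys) t) \<le> e" by simp
  qed (use xs ys in auto)
qed

definition trig_prod :: "(real \<times> real) list \<Rightarrow> (real \<times> real) list \<Rightarrow> (real \<times> real) list" where
  "trig_prod xs ys = concat (map (\<lambda>(c, l). map (\<lambda>(d, m). (c * d, l + m)) ys) xs)"

lemma trig_sum_prod: "trig_sum (trig_prod xs ys) t = trig_sum xs t * trig_sum ys t"
proof -
  have *: "trig_sum (map (\<lambda>(d, m). (c * d, l + m)) ys) t = of_real c * cis (l * t) * trig_sum ys t" for c l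
    by (induction ys) (auto simp: algebra_simps simp flip: cis_mult)
  show ?thesis
  proof (induction xs)
    case (Cons a xs)
    obtain c l where a: "a = (c, l)" by (cases a)
    have "trig_sum (trig_prod (a # xs) ys) t
        = of_real c * cis (l * t) * trig_sum ys t + trig_sum (trig_prod xs ys) t"
      by (simp add: trig_prod_def a *)
    thus ?case using Cons by (simp add: a algebra_simps)
  qed (auto simp: trig_prod_def)
qed

lemma trig_sum_bounded: "norm (trig_sum xs t) \<le> (\<Sum>(c, l)\<leftarrow>xs. \<bar>c\<bar>)"
proof (induction xs)
  case (Cons a xs)
  obtain c l where a: "a = (c, l)" by (cases a)
  have "norm (of_real c * cis (l * t) + trig_sum xs t) \<le> \<bar>c\<bar> + (\<Sum>(c, l)\<leftarrow>xs. \<bar>c\<bar>)"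
    using Cons by (intro norm_triangle_mono) (auto simp: norm_mult)
  thus ?case by (simp add: a)
qed auto

lemma positive_ap_bounded:
  assumes "positive_ap f"
  obtains B where "B > 0" "\<And>t. norm (f t) \<le> B"
proof -
  obtain xs where xs: "\<And>t. norm (f t - trig_sum xs t) \<le> 1"
    using positive_apE[OF assms, of 1] by (metis zero_less_one)
  let ?S = "\<Sum>(c, l)\<leftarrow>xs. \<bar>c\<bar>"
  have "norm (f t) \<le> 1 + ?S" for t
    using norm_triangle_mono[OF xs trig_sum_bounded, of t xs t] by simp
  moreover have "?S \<ge> 0" by (intro sum_list_nonneg) auto
  ultimately show ?thesis using that[of "1 + ?S"] by simp
qed

lemma positive_ap_mult:
  assumes "positive_ap f" "positive_ap g"
  shows "positive_ap (\<lambda>t. f t * g t)"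
  unfolding positive_ap_def
proof (intro allI impI)
  fix e :: real assume e: "e > 0"
  \<comment> \<open>The tolerance for \<open>f\<close> uses a bound for \<open>g\<close>; the
    tolerance for \<open>g\<close> then uses a bound for the chosen sum \<open>xs\<close>, with 1
    added in \<open>A\<close> to keep it positive.\<close>
  obtain B where B: "B > 0" "\<And>t. norm (g t) \<le> B" using positive_ap_bounded[OF assms(2)] by blast
  obtain xs where xs: "\<forall>(c, l)\<in>set xs. c \<ge> 0" "\<And>t. norm (f t - trig_sum xs t) \<le> e / 2 / B"
    using positive_apE[OF assms(1), of "e / 2 / B"] e B by auto
  define A where "A = (\<Sum>(c, l)\<leftarrow>xs. \<bar>c\<bar>) + 1"
  have A: "A > 0" unfolding A_def by (intro add_nonneg_pos sum_list_nonneg) auto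
  obtain ys where ys: "\<forall>(c, l)\<in>set ys. c \<ge> 0" "\<And>t. norm (g t - trig_sum ys t) \<le> e / 2 / A"
    using positive_apE[OF assms(2), of "e / 2 / A"] e A by auto
  show "\<exists>zs. (\<forall>(c, l)\<in>set zs. c \<ge> 0) \<and> (\<forall>t. norm (f t * g t - trig_sum zs t) \<le> e)"
  proof (intro exI[of _ "trig_prod xs ys"] conjI allI)
    fix t
    have "norm (f t * g t - trig_sum (trig_prod xs ys) t)
        = norm ((f t - trig_sum xs t) * g t + trig_sum xs t * (g t - trig_sum ys t))"
      by (simp add: trig_sum_prod algebra_simps)
    also have "\<dots> \<le> e / 2 / B * B + A * (e / 2 / A)"
    proof (intro norm_triangle_mono)
      show "norm ((f t - trig_sum xs t) * g t) \<le> e / 2 / B * B"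
        unfolding norm_mult using xs B e by (intro mult_mono) auto
      have "norm (trig_sum xs t) \<le> A" using trig_sum_bounded[of xs t] by (simp add: A_def)
      thus "norm (trig_sum xs t * (g t - trig_sum ys t)) \<le> A * (e / 2 / A)"
        unfolding norm_mult using ys A by (intro mult_mono) auto
    qed
    also have "\<dots> = e" using A B by simp
    finally show "norm (f t * g t - trig_sum (trig_prod xs ys) t) \<le> e" .
  next
    show "\<forall>(c, l)\<in>set (trig_prod xs ys). c \<ge> 0" using xs(1) ys(1) by (fastforce simp: trig_prod_def)
  qed
qed

lemma positive_ap_cnj:
  assumes "positive_ap f"
  shows "positive_ap (\<lambda>t. cnj (f t))"
  unfolding positive_ap_def
proof (intro allI impI)
  fix e :: real assume e: "e > 0"
  obtain xs where xs: "\<forall>(c, l)\<in>set xs. c \<ge> 0" "\<And>t. norm (f t - trig_sum xs t) \<le> e"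
    using positive_apE[OF assms e] by auto
  let ?ys = "map (\<lambda>(c, l). (c, - l)) xs"
  have *: "trig_sum ?ys t = cnj (trig_sum xs t)" for t
    by (induction xs) (auto simp: cis_cnj)
  show "\<exists>zs. (\<forall>(c, l)\<in>set zs. c \<ge> 0) \<and> (\<forall>t. norm (cnj (f t) - trig_sum zs t) \<le> e)"
  proof (intro exI[of _ ?ys] conjI allI)
    show "norm (cnj (f t) - trig_sum ?ys t) \<le> e" for t
      unfolding * using xs(2)[of t] by (simp flip: complex_cnj_diff)
  qed (use xs(1) in auto)
qed

lemma positive_ap_uniform_limit:
  assumes "\<And>e. e > 0 \<Longrightarrow> \<exists>g. positive_ap g \<and> (\<forall>t. norm (f t - g t) \<le> e)"
  shows "positive_ap f"
  unfolding positive_ap_def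
proof (intro allI impI)
  fix e :: real assume e: "e > 0"
  obtain g where g: "positive_ap g" "\<And>t. norm (f t - g t) \<le> e / 2" using assms[of "e / 2"] e by auto
  obtain xs where xs: "\<forall>(c, l)\<in>set xs. c \<ge> 0" "\<And>t. norm (g t - trig_sum xs t) \<le> e / 2"
    using positive_apE[OF g(1), of "e / 2"] e by auto
  have "norm (f t - trig_sum xs t) \<le> e" for t
    using norm_triangle_mono[OF g(2) xs(2), of t t] by simp
  thus "\<exists>zs. (\<forall>(c, l)\<in>set zs. c \<ge> 0) \<and> (\<forall>t. norm (f t - trig_sum zs t) \<le> e)" using xs(1) by blast
qed

lemma positive_ap_sum:
  "finite A \<Longrightarrow> (\<And>i. i \<in> A \<Longrightarrow> positive_ap (f i)) \<Longrightarrow> positive_ap (\<lambda>t. \<Sum>i\<in>A. f i t)"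
  by (induction A rule: finite_induct) (use positive_ap_const[of 0] in \<open>auto intro: positive_ap_add\<close>)

lemma positive_ap_prod:
  "finite A \<Longrightarrow> (\<And>i. i \<in> A \<Longrightarrow> positive_ap (f i)) \<Longrightarrow> positive_ap (\<lambda>t. \<Prod>i\<in>A. f i t)"
  by (induction A rule: finite_induct) (use positive_ap_const[of 1] in \<open>auto intro: positive_ap_mult\<close>)

lemma one_minus_cis_nonzero:
  assumes "0 \<le> q" "q < 1"
  shows "1 - of_real q * cis x \<noteq> 0"
proof
  assume "1 - of_real q * cis x = 0"
  hence "norm (of_real q * cis x) = 1" by simp
  thus False using assms by (simp add: norm_mult)
qed

text \<open>This is the geometric series without its constant term. Splitting off the 1 later gives
  the lower bound for the second moment of the resonator.\<close>

lemma positive_ap_geometric_minus_one: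
  assumes "0 \<le> q" "q < 1"
  shows "positive_ap (\<lambda>t. 1 / (1 - of_real q * cis (l * t)) - 1)"
proof (rule positive_ap_uniform_limit)
  fix e :: real assume e: "e > 0"
  have "(\<lambda>n. q ^ n / (1 - q)) \<longlonglongrightarrow> 0 / (1 - q)"
    using assms by (intro tendsto_intros LIMSEQ_realpow_zero) auto
  hence "eventually (\<lambda>n. q ^ n / (1 - q) < e) sequentially" using e by (simp add: order_tendstoD)
  then obtain n where n: "q ^ Suc n / (1 - q) < e"
    unfolding eventually_sequentially by (meson le_SucI order_refl)
  define g where "g = (\<lambda>t. \<Sum>k=1..n. of_real (q ^ k) * cis (real k * l * t))"
  have "norm (1 / (1 - of_real q * cis (l * t)) - 1 - g t) \<le> e" for t
  proof -
    let ?z = "of_real q * cis (l * t)"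
    have z: "?z \<noteq> 1" "norm ?z = q" using one_minus_cis_nonzero[OF assms, of "l * t"] assms
      by (auto simp: norm_mult)
    have zk: "?z ^ k = of_real (q ^ k) * cis (real k * l * t)" for k
      by (simp add: power_mult_distrib Complex.DeMoivre algebra_simps)
    have "1 + g t = (\<Sum>k\<le>n. ?z ^ k)"
      unfolding g_def zk by (simp add: atMost_atLeast0 sum.atLeast_Suc_atMost)
    also have "\<dots> = (1 - ?z ^ Suc n) / (1 - ?z)" using z by (subst sum_gp0) auto
    finally have "1 / (1 - ?z) - 1 - g t = ?z ^ Suc n / (1 - ?z)"
      using z by (simp add: field_simps)
    also have "norm \<dots> = q ^ Suc n / norm (1 - ?z)" using z by (simp only: norm_divide norm_power)
    also have "\<dots> \<le> q ^ Suc n / (1 - q)"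
      using norm_triangle_ineq2[of 1 ?z] z assms by (intro divide_left_mono) auto
    finally show ?thesis using n by linarith
  qed
  moreover have "positive_ap g" unfolding g_def
    using assms by (intro positive_ap_sum positive_ap_cis) auto
  ultimately show "\<exists>g. positive_ap g \<and> (\<forall>t. norm (1 / (1 - of_real q * cis (l * t)) - 1 - g t) \<le> e)"
    by blast
qed

lemma positive_ap_geometric:
  assumes "0 \<le> q" "q < 1"
  shows "positive_ap (\<lambda>t. 1 / (1 - of_real q * cis (l * t)))"
  using positive_ap_add[OF positive_ap_geometric_minus_one[OF assms] positive_ap_const[of 1]] by simp

lemma positive_ap_continuous:
  assumes "positive_ap f"
  shows "continuous_on A f"
proof -
  have "\<forall>n::nat. \<exists>xs. \<forall>t. norm (f t - trig_sum xs t) \<le> 1 / Suc n"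
  proof
    fix n :: nat
    show "\<exists>xs. \<forall>t. norm (f t - trig_sum xs t) \<le> 1 / Suc n"
      by (rule positive_apE[OF assms, of "1 / Suc n"]) auto
  qed
  then obtain X where X: "\<And>n t. norm (f t - trig_sum (X n) t) \<le> 1 / Suc n" by metis
  show ?thesis
  proof (rule uniform_limit_theorem)
    show "\<forall>\<^sub>F n in sequentially. continuous_on A (\<lambda>t. trig_sum (X n) t)"
    proof (intro always_eventually allI)
      fix n
      have "continuous_on A (\<lambda>t. trig_sum xs t)" for xs
        by (induction xs) (auto intro!: continuous_intros)
      thus "continuous_on A (\<lambda>t. trig_sum (X n) t)" .
    qed
    show "uniform_limit A (\<lambda>n t. trig_sum (X n) t) f sequentially"
    proof (rule uniform_limitI)
      fix e :: real assume "e > 0"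
      moreover have "(\<lambda>n. 1 / real (Suc n)) \<longlonglongrightarrow> 0" by real_asymp
      ultimately have "eventually (\<lambda>n. 1 / real (Suc n) < e) sequentially" by (rule order_tendstoD[rotated])
      thus "\<forall>\<^sub>F n in sequentially. \<forall>t\<in>A. dist (trig_sum (X n) t) (f t) < e"
        by eventually_elim (metis X dist_commute dist_norm le_less_trans)
    qed
  qed auto
qed

text \<open>The right side is a value of the Fejer kernel. It is nonnegative for every frequency,
  which is the reason for the triangular weight.\<close>

lemma fejer_integral_cos:
  fixes T l :: real
  assumes "T > 0"
  shows "((\<lambda>t. (1 - t / T) * cos (l * t)) has_integral
           (if l = 0 then T / 2 else (1 - cos (l * T)) / (T * l\<^sup>2))) {0..T}"
proof (cases "l = 0")
  case True
  have "((\<lambda>t. 1 - t / T) has_integral (T - T\<^sup>2 / (2 * T)) - (0 - 0\<^sup>2 / (2 * T))) {0..T}"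
    using assms by (intro fundamental_theorem_of_calculus[where f = "\<lambda>t. t - t\<^sup>2 / (2 * T)"])
      (auto intro!: derivative_eq_intros simp flip: has_real_derivative_iff_has_vector_derivative)
  thus ?thesis using True assms by (simp add: power2_eq_square field_simps)
next
  case False
  define F where "F = (\<lambda>t. (1 - t / T) * sin (l * t) / l - cos (l * t) / (T * l\<^sup>2))"
  have "((\<lambda>t. (1 - t / T) * cos (l * t)) has_integral F T - F 0) {0..T}"
    unfolding F_def using assms False by (intro fundamental_theorem_of_calculus)
      (auto intro!: derivative_eq_intros simp flip: has_real_derivative_iff_has_vector_derivative
        simp: power2_eq_square field_simps)
  thus ?thesis using False assms by (simp add: F_def diff_divide_distrib)
qed

text \<open>For a finite sum the integral is a nonnegative combination of Fejer kernel values. A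
  uniform error \<open>e / T\<close>, weighted by at most 1, costs at most \<open>e\<close> over the
  interval.\<close>

lemma positive_ap_integral_nonneg:
  assumes "positive_ap f" "T > 0"
  shows "integral {0..T} (\<lambda>t. (1 - t / T) * Re (f t)) \<ge> 0"
proof (rule field_le_epsilon)
  fix e :: real assume e: "e > 0"
  obtain xs where xs: "\<forall>(c, l)\<in>set xs. c \<ge> 0" "\<And>t. norm (f t - trig_sum xs t) \<le> e / T"
    using positive_apE[OF assms(1), of "e / T"] e assms by auto
  have "\<exists>I\<ge>0. ((\<lambda>t. (1 - t / T) * Re (trig_sum xs t)) has_integral I) {0..T}"
    using xs(1)
  proof (induction xs)
    case Nil
    show ?case by (intro exI[of _ 0]) auto
  next
    case (Cons a xs)
    obtain c l where a: "a = (c, l)" by (cases a)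
    obtain I where I: "I \<ge> 0" "((\<lambda>t. (1 - t / T) * Re (trig_sum xs t)) has_integral I) {0..T}"
      using Cons by auto
    define J where "J = (if l = 0 then T / 2 else (1 - cos (l * T)) / (T * l\<^sup>2))"
    have J: "J \<ge> 0" using assms by (auto simp: J_def)
    have "((\<lambda>t. c * ((1 - t / T) * cos (l * t)) + (1 - t / T) * Re (trig_sum xs t)) has_integral c * J + I) {0..T}"
      unfolding J_def by (intro has_integral_add has_integral_mult_right fejer_integral_cos I assms)
    moreover have "c \<ge> 0" using Cons.prems a by auto
    ultimately show ?case using I J
      by (intro exI[of _ "c * J + I"]) (auto simp: a algebra_simps)
  qed
  then obtain I where I: "I \<ge> 0" "((\<lambda>t. (1 - t / T) * Re (trig_sum xs t)) has_integral I) {0..T}" by blast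
  have "((\<lambda>t. (1 - t / T) * Re (trig_sum xs t) - e / T) has_integral I - e / T * T) {0..T}"
    using has_integral_diff[OF I(2) has_integral_const_real[of "e / T" 0 T]] assms by simp
  moreover have "(\<lambda>t. (1 - t / T) * Re (f t)) integrable_on {0..T}"
    using assms by (intro integrable_continuous_real continuous_intros positive_ap_continuous) auto
  moreover have "(1 - t / T) * Re (trig_sum xs t) - e / T \<le> (1 - t / T) * Re (f t)" if "t \<in> {0..T}" for t
  proof -
    have w: "0 \<le> 1 - t / T" "1 - t / T \<le> 1" using that assms by auto
    have "Re (trig_sum xs t) - Re (f t) \<le> norm (f t - trig_sum xs t)"
      using complex_Re_le_cmod[of "trig_sum xs t - f t"] by (simp add: norm_minus_commute)
    also note xs(2)
    finally have "(1 - t / T) * (Re (trig_sum xs t) - Re (f t)) \<le> (1 - t / T) * (e / T)"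
      using w by (intro mult_left_mono) auto
    also have "\<dots> \<le> 1 * (e / T)" using w e assms by (intro mult_right_mono) auto
    finally show ?thesis by (simp add: algebra_simps)
  qed
  ultimately have "I - e / T * T \<le> integral {0..T} (\<lambda>t. (1 - t / T) * Re (f t))"
    by (meson has_integral_le integrable_integral)
  thus "0 \<le> integral {0..T} (\<lambda>t. (1 - t / T) * Re (f t)) + e" using I(1) assms by simp
qed

subsection \<open>The zeta function to the right of the imaginary axis\<close>

text \<open>With \<open>k = Suc n\<close> and \<open>s\<close> not 1, this is
  \<open>k powr -s\<close> minus the integral of \<open>x powr -s\<close> over
  \<open>[k, k + 1]\<close>.\<close>

definition zeta_term :: "nat \<Rightarrow> complex \<Rightarrow> complex" where
  "zeta_term n s = of_nat (Suc n) powr -s - (of_nat (Suc (Suc n)) powr (1 - s) - of_nat (Suc n) powr (1 - s)) / (1 - s)"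

text \<open>For \<open>Re s > 1\<close> the summand \<open>1 / (s - 1)\<close> restores the integral
  of \<open>x powr -s\<close> from 1 to infinity. The series itself also converges for
  \<open>Re s > 0\<close> away from \<open>s = 1\<close>.\<close>

definition zeta_series :: "complex \<Rightarrow> complex" where
  "zeta_series s = 1 / (s - 1) + (\<Sum>n. zeta_term n s)"

text \<open>The term is the integral of \<open>a powr -s - x powr -s\<close> over a unit interval.
  Two mean value inequalities replace the integration, the derivative of \<open>x powr -s\<close>
  being bounded by \<open>B\<close>.\<close>

lemma norm_zeta_term_le:
  assumes "Re s > 0" "s \<noteq> 1"
  shows "norm (zeta_term n s) \<le> norm s * real (Suc n) powr (- Re s - 1)"
proof -
  define a where "a = real (Suc n)"
  define S where "S = complex_of_real ` {a..a + 1}"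
  define B where "B = norm s * a powr (- Re s - 1)"
  have a: "a \<ge> 1" by (simp add: a_def)
  have S_alt: "S = closed_segment (of_real a) (of_real (a + 1))"
    unfolding S_def closed_segment_of_real by (subst closed_segment_eq_real_ivl) auto
  have conv: "convex S" unfolding S_alt by (rule convex_closed_segment)
  have nonpos: "z \<notin> \<real>\<^sub>\<le>\<^sub>0" if "z \<in> S" for z using that a by (auto simp: S_def complex_nonpos_Reals_iff)
  have ends: "of_real a \<in> S" "of_real (a + 1) \<in> S" 
    unfolding S_def using imageI[of a "{a..a + 1}" complex_of_real]
      imageI[of "a + 1" "{a..a + 1}" complex_of_real] by simp_all
  have inner: "norm (z powr -s - of_real a powr -s) \<le> B" if "z \<in> S" for z
  proof -
    have "norm (z powr -s - of_real a powr -s) \<le> B * norm (z - of_real a)"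
    proof (rule field_differentiable_bound[where S = S and f = "\<lambda>z. z powr -s" and f' = "\<lambda>z. -s * z powr (-s - 1)"])
      fix w assume w: "w \<in> S"
      show "((\<lambda>z. z powr -s) has_field_derivative -s * w powr (-s - 1)) (at w within S)"
        by (rule has_field_derivative_at_within[OF has_field_derivative_powr[OF nonpos[OF w]]])
      obtain x where x: "w = of_real x" "a \<le> x" using w by (auto simp: S_def)
      have "norm (- s * w powr (-s - 1)) = norm s * x powr (- Re s - 1)"
        using x a by (simp add: norm_mult norm_powr_real_powr)
      also have "\<dots> \<le> B" unfolding B_def
        using x a assms by (intro mult_left_mono powr_mono2') auto
      finally show "norm (- s * w powr (-s - 1)) \<le> B" .
    qed (fact conv that ends(1))+
    also have "\<dots> \<le> B * 1"
    proof (rule mult_left_mono)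
      obtain x where "z = of_real x" "a \<le> x" "x \<le> a + 1" using \<open>z \<in> S\<close> by (auto simp: S_def)
      thus "norm (z - of_real a) \<le> 1" by (simp flip: of_real_diff)
    qed (simp add: B_def)
    finally show ?thesis by simp
  qed
  \<comment> \<open>The derivative \<open>of_real a powr -s - z powr -s\<close> of \<open>F\<close>
    is bounded by \<open>inner\<close>, and the increment of \<open>F\<close> over the unit interval
    is \<open>zeta_term n s\<close>.\<close>
  define F where "F = (\<lambda>z. z * of_real a powr -s - z powr (1 - s) / (1 - s))"
  have "norm (F (of_real (a + 1)) - F (of_real a)) \<le> B * norm (of_real (a + 1) - of_real a :: complex)"
  proof (rule field_differentiable_bound[where S = S and f = F and f' = "\<lambda>z. of_real a powr -s - z powr -s"])
    fix w assume w: "w \<in> S"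
    have "((\<lambda>z. z powr (1 - s)) has_field_derivative (1 - s) * w powr (1 - s - 1)) (at w within S)"
      by (rule has_field_derivative_at_within[OF has_field_derivative_powr[OF nonpos[OF w]]])
    from DERIV_diff[OF DERIV_cmult_right[OF DERIV_ident] DERIV_cdivide[OF this, of "1 - s"], of "of_real a powr -s"]
    have "(F has_field_derivative of_real a powr -s - (1 - s) * w powr (1 - s - 1) / (1 - s)) (at w within S)"
      unfolding F_def by simp
    thus "(F has_field_derivative of_real a powr -s - w powr -s) (at w within S)"
      using assms(2) by simp
    show "norm (of_real a powr -s - w powr -s) \<le> B" using inner[OF w] by (simp add: norm_minus_commute)
  qed (fact conv ends)+
  also have "F (of_real (a + 1)) - F (of_real a) = zeta_term n s"
    by (simp add: F_def zeta_term_def a_def diff_divide_distrib algebra_simps)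
  finally show ?thesis by (simp add: B_def a_def)
qed

lemma summable_powr_neg: "\<sigma> > 0 \<Longrightarrow> summable (\<lambda>n. c * real (Suc n) powr (- \<sigma> - 1))"
  by (intro summable_mult, subst summable_Suc_iff, subst summable_real_powr_iff) auto

lemma summable_zeta_term: "Re s > 0 \<Longrightarrow> s \<noteq> 1 \<Longrightarrow> summable (\<lambda>n. zeta_term n s)"
  by (rule summable_comparison_test'[OF summable_powr_neg[of "Re s" "norm s"] norm_zeta_term_le])

lemma sum_zeta_term:
  assumes "s \<noteq> 1"
  shows "(\<Sum>n<N. zeta_term n s) =
         (\<Sum>n<N. of_nat (Suc n) powr -s) - (of_nat (Suc N) powr (1 - s) - 1) / (1 - s)"
  by (induction N) (simp_all add: zeta_term_def diff_divide_distrib)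

lemma zeta_series_holomorphic: "zeta_series holomorphic_on {z. Re z > 0} - {1}"
proof -
  let ?S = "{z. Re z > 0} - {1::complex}"
  have op: "open ?S" by (intro open_delete open_halfspace_Re_gt)
  have "(\<lambda>s. \<Sum>n. zeta_term n s) holomorphic_on ?S"
  proof (rule holomorphic_uniform_sequence[OF op])
    show "(\<lambda>s. \<Sum>n<N. zeta_term n s) holomorphic_on ?S" for N
      unfolding zeta_term_def by (intro holomorphic_intros) auto
    fix z assume z: "z \<in> ?S"
    obtain d where d: "d > 0" "cball z d \<subseteq> ?S" using op z open_contains_cball by blast
    \<comment> \<open>The least real part in the disc, attained at \<open>z - d\<close>. The disc
      lies in the half-plane, so it is positive and gives a uniform majorant.\<close>
    define \<sigma> where "\<sigma> = Re z - d"
    have "z - of_real d \<in> cball z d" using d by (simp add: dist_norm)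
    hence "z - of_real d \<in> ?S" using d by blast
    hence sig: "\<sigma> > 0" by (simp add: \<sigma>_def)
    have "uniform_limit (cball z d) (\<lambda>N s. \<Sum>n<N. zeta_term n s) (\<lambda>s. \<Sum>n. zeta_term n s) sequentially"
    proof (rule Weierstrass_m_test)
      show "summable (\<lambda>n. (norm z + d) * real (Suc n) powr (- \<sigma> - 1))" by (rule summable_powr_neg[OF sig])
      fix n s assume s: "s \<in> cball z d"
      have "norm (s - z) \<le> d" using s by (simp add: dist_norm norm_minus_commute)
      moreover have "\<bar>Re (s - z)\<bar> \<le> norm (s - z)" by (rule abs_Re_le_cmod)
      ultimately have "Re s \<ge> \<sigma>" "norm s \<le> norm z + d"
        using norm_triangle_sub[of s z] by (auto simp: \<sigma>_def)
      moreover have "Re s > 0" "s \<noteq> 1" using d s by auto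
      ultimately have "norm s * real (Suc n) powr (- Re s - 1) \<le> (norm z + d) * real (Suc n) powr (- \<sigma> - 1)"
        using d(1) by (intro mult_mono powr_mono) auto
      thus "norm (zeta_term n s) \<le> (norm z + d) * real (Suc n) powr (- \<sigma> - 1)"
        using norm_zeta_term_le[OF \<open>Re s > 0\<close> \<open>s \<noteq> 1\<close>, of n] by linarith
    qed
    thus "\<exists>d>0. cball z d \<subseteq> ?S \<and> uniform_limit (cball z d) (\<lambda>N s. \<Sum>n<N. zeta_term n s) (\<lambda>s. \<Sum>n. zeta_term n s) sequentially"
      using d by blast
  qed
  moreover have "(\<lambda>s. 1 / (s - 1)) holomorphic_on ?S" by (intro holomorphic_intros) auto
  ultimately have "(\<lambda>s. 1 / (s - 1) + (\<Sum>n. zeta_term n s)) holomorphic_on ?S" by (intro holomorphic_on_add)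
  thus ?thesis by (simp add: zeta_series_def[abs_def])
qed

text \<open>For \<open>Re s > 1\<close> the telescoped integrals tend to \<open>1 / (s - 1)\<close>,
  because \<open>N powr (1 - s)\<close> tends to 0; this turns \<open>zeta_series\<close> back into
  the Dirichlet series.\<close>

lemma zeta_continuation_zeta_series: "zeta_continuation 0 zeta_series"
  unfolding zeta_continuation_def
proof (intro conjI allI impI)
  show "zeta_series holomorphic_on {z. Re z > 0} - {1}" by (rule zeta_series_holomorphic)
  fix s :: complex assume s: "Re s > 1"
  hence s1: "s \<noteq> 1" by auto
  have "(\<lambda>N. (\<Sum>n<N. zeta_term n s) + (of_nat (Suc N) powr (1 - s) - 1) / (1 - s))
          \<longlonglongrightarrow> (\<Sum>n. zeta_term n s) + (0 - 1) / (1 - s)"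
  proof (intro tendsto_intros summable_LIMSEQ summable_zeta_term)
    show "(\<lambda>N. of_nat (Suc N) powr (1 - s)) \<longlonglongrightarrow> 0"
    proof (rule tendsto_norm_zero_cancel)
      have "(\<lambda>N. real (Suc N) powr (1 - Re s)) \<longlonglongrightarrow> 0" using s by real_asymp
      moreover have "norm (of_nat (Suc N) powr (1 - s)) = real (Suc N) powr (1 - Re s)" for N
        using norm_powr_real_powr[of "of_nat (Suc N)" "1 - s"] by simp
      ultimately show "(\<lambda>N. norm (of_nat (Suc N) powr (1 - s))) \<longlonglongrightarrow> 0" by simp
    qed
  qed (use s s1 in auto)
  moreover have "(\<Sum>n. zeta_term n s) + (0 - 1) / (1 - s) = zeta_series s"
  proof -
    have "(0 - 1) / (1 - s) = 1 / (s - 1)" by (metis diff_0 minus_diff_eq minus_divide_divide)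
    thus ?thesis by (simp add: zeta_series_def)
  qed
  moreover have "(\<lambda>N. (\<Sum>n<N. zeta_term n s) + (of_nat (Suc N) powr (1 - s) - 1) / (1 - s))
      = (\<lambda>N. \<Sum>n<N. 1 / of_nat (Suc n) powr s)"
    using sum_zeta_term[OF s1] by (simp add: powr_minus inverse_eq_divide)
  ultimately show "(\<lambda>n. 1 / of_nat (Suc n) powr s) sums zeta_series s" by (simp add: sums_def)
qed

lemma riemann_zeta_eq_zeta_series: "Re s > 0 \<Longrightarrow> s \<noteq> 1 \<Longrightarrow> riemann_zeta s = zeta_series s"
  using riemann_zeta_eq[OF zeta_continuation_zeta_series] by simp

section \<open>The zeta function on the 1-line\<close>

lemma continuous_on_zeta_one_line:
  "continuous_on {0<..} (\<lambda>t. riemann_zeta (1 + \<i> * of_real t))"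
proof -
  have "continuous_on {0<..} (\<lambda>t::real. zeta_series (1 + \<i> * of_real t))"
    by (rule continuous_on_compose2[OF holomorphic_on_imp_continuous_on[OF zeta_series_holomorphic]])
      (auto intro!: continuous_intros simp: complex_eq_iff)
  thus ?thesis
    by (rule continuous_on_eq) (subst riemann_zeta_eq_zeta_series, auto simp: complex_eq_iff)
qed

text \<open>After the pole terms cancel, two parts remain: the tail of \<open>zeta_term\<close>, at
  most \<open>norm s\<close> times a telescoping majorant of the sum of \<open>1 / k ^ 2\<close>,
  and a boundary term of modulus \<open>1 / t\<close>, as \<open>of_nat (Suc N) powr (1 - s)\<close>
  has modulus 1.\<close>

lemma norm_zeta_one_line_minus_sum_le:
  assumes t: "t > 0" and N: "N \<ge> 1"
  shows "norm (riemann_zeta (1 + \<i> * of_real t) - (\<Sum>k=1..N. of_real (1 / real k) * cis (- ln (real k) * t)))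
          \<le> 1 / t + (1 + t) / N"
proof -
  define s where "s = 1 + \<i> * complex_of_real t"
  have s: "s \<noteq> 1" "Re s = 1" using t by (auto simp: s_def complex_eq_iff)
  have norm_s: "norm s \<le> 1 + t" using norm_triangle_ineq[of 1 "\<i> * complex_of_real t"] t
    by (simp add: s_def norm_mult)
  have dirichlet: "of_nat k powr -s = of_real (1 / real k) * cis (- ln (real k) * t)" if "k \<ge> 1" for k
  proof -
    have "of_nat k powr -s = exp (-s * of_real (ln (real k)))"
      using that by (simp add: powr_def Ln_of_nat)
    also have "-s * of_real (ln (real k)) = of_real (- ln (real k)) + \<i> * of_real (- ln (real k) * t)"
      by (simp add: s_def algebra_simps)
    also have "exp \<dots> = of_real (1 / real k) * cis (- ln (real k) * t)"
      using that unfolding exp_add cis_conv_exp exp_of_real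
      by (simp add: exp_minus inverse_eq_divide)
    finally show ?thesis .
  qed
  have "(\<Sum>k=1..N. of_real (1 / real k) * cis (- ln (real k) * t)) = (\<Sum>k=1..N. of_nat k powr -s)"
    using dirichlet by simp
  also have "\<dots> = (\<Sum>n<N. of_nat (Suc n) powr -s)"
    by (rule sum.reindex_bij_witness[of _ Suc "\<lambda>k. k - 1"]) auto
  finally have sum_eq: "(\<Sum>k=1..N. of_real (1 / real k) * cis (- ln (real k) * t)) = \<dots>" .
  have sm: "summable (\<lambda>n. zeta_term n s)" using s by (intro summable_zeta_term) auto
  have "riemann_zeta s = 1 / (s - 1) + ((\<Sum>n. zeta_term (n + N) s) + (\<Sum>n<N. zeta_term n s))"
    using s riemann_zeta_eq_zeta_series[of s] suminf_split_initial_segment[OF sm, of N]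
    by (simp add: zeta_series_def)
  moreover have "(\<Sum>n<N. zeta_term n s) = (\<Sum>n<N. of_nat (Suc n) powr -s)
      - (1 / (s - 1) - of_nat (Suc N) powr (1 - s) / (s - 1))"
  proof -
    have "x / (1 - s) = - (x / (s - 1))" for x by (metis minus_diff_eq minus_divide_right)
    thus ?thesis unfolding sum_zeta_term[OF s(1)] by (simp only: diff_divide_distrib minus_diff_eq)
  qed
  \<comment> \<open>Here \<open>u\<close> is the pole term \<open>1 / (s - 1)\<close>,
    \<open>v\<close> the boundary term, \<open>A\<close> the tail and \<open>S\<close> the Dirichlet
    sum; the two copies of \<open>u\<close> cancel.\<close>
  moreover have "r - S = A + v" if "r = u + (A + D)" "D = S - (u - v)" for r u A D S v :: complex
    using that by (simp add: algebra_simps)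
  ultimately have "riemann_zeta s - (\<Sum>n<N. of_nat (Suc n) powr -s)
      = (\<Sum>n. zeta_term (n + N) s) + of_nat (Suc N) powr (1 - s) / (s - 1)"
    by blast
  also have "norm \<dots> \<le> (1 + t) / N + 1 / t"
  proof (intro norm_triangle_mono)
    have "norm (of_nat (Suc N) powr (1 - s)) = 1"
      using norm_powr_real_powr[of "of_nat (Suc N)" "1 - s"] s by simp
    moreover have "norm (s - 1) = t" using t by (simp add: s_def norm_mult)
    ultimately show "norm (of_nat (Suc N) powr (1 - s) / (s - 1)) \<le> 1 / t" by (simp only: norm_divide order_refl)
    have "(\<lambda>n. 1 / real (n + N)) \<longlonglongrightarrow> 0" by real_asymp
    from telescope_sums'[OF this] have tele: "(\<lambda>n. 1 / real (n + N) - 1 / real (Suc n + N)) sums (1 / N)" by simp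
    have tele': "(\<lambda>n. (1 + t) * (1 / real (n + N) - 1 / real (Suc n + N))) sums ((1 + t) * (1 / N))"
      by (rule sums_mult[OF tele])
    have bound: "norm (zeta_term (n + N) s) \<le> (1 + t) * (1 / real (n + N) - 1 / real (Suc n + N))" for n
    proof -
      have "norm (zeta_term (n + N) s) \<le> norm s * real (Suc (n + N)) powr - 2"
        using norm_zeta_term_le[of s "n + N"] s by simp
      also have "real (Suc (n + N)) powr - 2 = 1 / (real (Suc (n + N)) * real (Suc (n + N)))"
        by (simp add: powr_minus inverse_eq_divide power2_eq_square)
      also have "\<dots> \<le> 1 / (real (n + N) * real (Suc (n + N)))"
        using N by (intro divide_left_mono mult_right_mono) auto
      also have "\<dots> = 1 / real (n + N) - 1 / real (Suc n + N)" using N by (simp add: field_simps)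
      finally have "norm (zeta_term (n + N) s) \<le> norm s * (1 / real (n + N) - 1 / real (Suc n + N))"
        by (simp add: mult_left_mono)
      also have "\<dots> \<le> (1 + t) * (1 / real (n + N) - 1 / real (Suc n + N))"
        using norm_s N by (intro mult_right_mono) (auto intro!: divide_left_mono)
      finally show ?thesis .
    qed
    have "norm (\<Sum>n. zeta_term (n + N) s) \<le> (\<Sum>n. (1 + t) * (1 / real (n + N) - 1 / real (Suc n + N)))"
      by (rule norm_suminf_le[OF bound sums_summable[OF tele']])
    also have "\<dots> = (1 + t) / N" using sums_unique[OF tele'] by simp
    finally show "norm (\<Sum>n. zeta_term (n + N) s) \<le> (1 + t) / N" .
  qed
  finally show ?thesis unfolding sum_eq s_def by (simp add: add.commute)
qed

subsection \<open>The resonance method\<close>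

definition mult_ext :: "(nat \<Rightarrow> real) \<Rightarrow> nat \<Rightarrow> real" where
  "mult_ext q k = (\<Prod>p\<in>#prime_factorization k. q p)"

lemma mult_ext_1: "mult_ext q 1 = 1"
  by (simp add: mult_ext_def)

lemma mult_ext_mult: "a > 0 \<Longrightarrow> b > 0 \<Longrightarrow> mult_ext q (a * b) = mult_ext q a * mult_ext q b"
  by (simp add: mult_ext_def prime_factorization_mult)

lemma mult_ext_prime: "prime p \<Longrightarrow> mult_ext q p = q p"
  by (simp add: mult_ext_def prime_factorization_prime)

text \<open>This is the Euler product of the series of \<open>mult_ext q n * cis (ln n * t)\<close>
  over the integers \<open>n\<close> with all prime factors in \<open>A\<close>. The frequencies are
  opposite to those of \<open>dirichlet_sum\<close>, so multiplying by
  \<open>cis (- ln k * t)\<close> shifts the index from \<open>k * n\<close> to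
  \<open>n\<close>.\<close>

definition resonator :: "nat set \<Rightarrow> (nat \<Rightarrow> real) \<Rightarrow> real \<Rightarrow> complex" where
  "resonator A q t = (\<Prod>p\<in>A. 1 / (1 - of_real (q p) * cis (ln (real p) * t)))"

definition dirichlet_sum :: "nat \<Rightarrow> real \<Rightarrow> complex" where
  "dirichlet_sum N t = (\<Sum>k=1..N. of_real (1 / real k) * cis (- ln (real k) * t))"

lemma norm_dirichlet_sum_le: "norm (dirichlet_sum N t) \<le> harm N"
proof -
  have "norm (dirichlet_sum N t) \<le> (\<Sum>k=1..N. norm (of_real (1 / real k) * cis (- ln (real k) * t)))"
    unfolding dirichlet_sum_def by (rule norm_sum)
  also have "\<dots> = harm N" by (simp add: norm_mult harm_def norm_divide inverse_eq_divide)
  finally show ?thesis .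
qed

lemma positive_ap_dirichlet_sum: "positive_ap (dirichlet_sum N)"
proof -
  have "positive_ap (\<lambda>t. \<Sum>k=1..N. of_real (1 / real k) * cis (- ln (real k) * t))"
    by (intro positive_ap_sum positive_ap_cis) auto
  thus ?thesis by (simp add: dirichlet_sum_def[abs_def])
qed

section \<open>The resonance inequality for a general multiplicative weight\<close>

context
  fixes A :: "nat set" and q :: "nat \<Rightarrow> real"
  assumes fin: "finite A" and primes: "\<And>p. p \<in> A \<Longrightarrow> prime p"
    and q: "\<And>p. p \<in> A \<Longrightarrow> 0 \<le> q p" "\<And>p. p \<in> A \<Longrightarrow> q p < 1"
begin

lemma positive_ap_resonator: "positive_ap (resonator A q)"
proof -
  have "positive_ap (\<lambda>t. \<Prod>p\<in>A. 1 / (1 - of_real (q p) * cis (ln (real p) * t)))"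
    by (intro positive_ap_prod positive_ap_geometric fin q)
  thus ?thesis by (simp add: resonator_def[abs_def])
qed

text \<open>The integer 1 contributes the constant coefficient 1. The induction rests on
  \<open>x * y - 1 = x * (y - 1) + (x - 1)\<close>, which keeps all coefficients
  nonnegative.\<close>

lemma positive_ap_resonator_minus_one: "positive_ap (\<lambda>t. resonator A q t - 1)"
proof -
  let ?f = "\<lambda>p t. 1 / (1 - of_real (q p) * cis (ln (real p) * t))"
  have "positive_ap (\<lambda>t. (\<Prod>p\<in>B. ?f p t) - 1)" if "B \<subseteq> A" for B
    using finite_subset[OF that fin] that
  proof (induction B rule: finite_induct)
    case empty
    show ?case using positive_ap_const[of 0] by simp
  next
    case (insert p B)
    have "positive_ap (\<lambda>t. ?f p t * ((\<Prod>p\<in>B. ?f p t) - 1) + (?f p t - 1))"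
      using insert by (intro positive_ap_add positive_ap_mult positive_ap_geometric
        positive_ap_geometric_minus_one q) auto
    moreover have "?f p t * ((\<Prod>p\<in>B. ?f p t) - 1) + (?f p t - 1) = (\<Prod>p\<in>insert p B. ?f p t) - 1" for t
    proof -
      have "x * (y - 1) + (x - 1) = x * y - 1" for x y :: complex by (simp add: algebra_simps)
      thus ?thesis using insert.hyps by (subst prod.insert)
    qed
    ultimately show ?case by (simp only:)
  qed
  thus ?thesis by (simp add: resonator_def)
qed

lemma norm_resonator_le: "norm (resonator A q t) \<le> (\<Prod>p\<in>A. 1 / (1 - q p))"
  unfolding resonator_def prod_norm[symmetric]
proof (intro prod_mono conjI norm_ge_zero)
  fix p assume p: "p \<in> A"
  have "1 - q p \<le> norm (1 - of_real (q p) * cis (ln (real p) * t))"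
    using norm_triangle_ineq2[of 1 "of_real (q p) * cis (ln (real p) * t)"] q[OF p]
    by (simp add: norm_mult)
  thus "norm (1 / (1 - of_real (q p) * cis (ln (real p) * t))) \<le> 1 / (1 - q p)"
    unfolding norm_divide norm_one using q[OF p] by (intro divide_left_mono) (auto intro!: mult_pos_pos)
qed

text \<open>The left factor equals \<open>cis (- ln p * t)\<close> times the reciprocal of the Euler factor at \<open>p\<close>.\<close>

lemma positive_ap_shift_prime:
  assumes "p \<in> A"
  shows "positive_ap (\<lambda>t. (cis (- ln (real p) * t) - of_real (q p)) * resonator A q t)"
proof -
  let ?z = "\<lambda>t. of_real (q p) * cis (ln (real p) * t)"
  have "positive_ap (\<lambda>t. of_real 1 * cis (- ln (real p) * t) *
          (\<Prod>p\<in>A - {p}. 1 / (1 - of_real (q p) * cis (ln (real p) * t))))"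
    using fin q by (intro positive_ap_mult positive_ap_prod positive_ap_cis positive_ap_geometric) auto
  moreover have "of_real 1 * cis (- ln (real p) * t) * (\<Prod>p\<in>A - {p}. 1 / (1 - of_real (q p) * cis (ln (real p) * t)))
      = (cis (- ln (real p) * t) - of_real (q p)) * resonator A q t" for t
  proof -
    let ?P = "\<Prod>p\<in>A - {p}. 1 / (1 - of_real (q p) * cis (ln (real p) * t))"
    have "resonator A q t = 1 / (1 - ?z t) * ?P"
      unfolding resonator_def using fin assms by (rule prod.remove)
    moreover have "cis (- ln (real p) * t) - of_real (q p) = cis (- ln (real p) * t) * (1 - ?z t)"
      by (simp add: right_diff_distrib mult.left_commute cis_mult)
    moreover have "1 - ?z t \<noteq> 0" using q[OF assms] by (rule one_minus_cis_nonzero)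
    ultimately show ?thesis by simp
  qed
  ultimately show ?thesis by simp
qed

text \<open>With \<open>u k = cis (- ln k * t)\<close> and \<open>q\<close> extended
  multiplicatively, \<open>u (a * b) - q (a * b) = u a * (u b - q b) + q b * (u a - q a)\<close>. So
  the property passes from the primes to their products.\<close>

lemma positive_ap_shift:
  assumes "k \<in> prime_power_products A E"
  shows "positive_ap (\<lambda>t. (cis (- ln (real k) * t) - of_real (mult_ext q k)) * resonator A q t)"
proof -
  define good where "good k \<longleftrightarrow> k > 0 \<and> mult_ext q k \<ge> 0 \<and>
    positive_ap (\<lambda>t. (cis (- ln (real k) * t) - of_real (mult_ext q k)) * resonator A q t)" for k
  have one: "good 1" using positive_ap_const[of 0] by (simp add: good_def mult_ext_1[simplified])
  have mult: "good (a * b)" if a: "good a" and b: "good b" for a b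
  proof -
    have "positive_ap (\<lambda>t. of_real 1 * cis (- ln (real a) * t) * ((cis (- ln (real b) * t) - of_real (mult_ext q b)) * resonator A q t)
       + of_real (mult_ext q b) * ((cis (- ln (real a) * t) - of_real (mult_ext q a)) * resonator A q t))"
      using a b unfolding good_def
      by (intro positive_ap_add positive_ap_mult[OF positive_ap_cis] positive_ap_mult[OF positive_ap_const]) auto
    moreover have "of_real 1 * cis (- ln (real a) * t) * ((cis (- ln (real b) * t) - of_real (mult_ext q b)) * resonator A q t)
       + of_real (mult_ext q b) * ((cis (- ln (real a) * t) - of_real (mult_ext q a)) * resonator A q t)
       = (cis (- ln (real (a * b)) * t) - of_real (mult_ext q (a * b))) * resonator A q t" for t
    proof -
      have "cis (- ln (real (a * b)) * t) = cis (- ln (real a) * t) * cis (- ln (real b) * t)"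
        using a b by (simp add: good_def ln_mult cis_mult algebra_simps)
      moreover have "mult_ext q (a * b) = mult_ext q a * mult_ext q b"
        using a b by (simp add: good_def mult_ext_mult)
      ultimately show ?thesis by (simp add: algebra_simps)
    qed
    ultimately show ?thesis using a b by (simp add: good_def mult_ext_mult)
  qed
  have prime: "good p" if "p \<in> A" for p
    using positive_ap_shift_prime[OF that] primes[OF that] q[OF that]
    by (simp add: good_def mult_ext_prime prime_gt_0_nat)
  have pow: "good (p ^ e)" if "p \<in> A" for p e
    by (induction e) (use one mult prime[OF that] in auto)
  have "good (\<Prod>p\<in>B. p ^ f p)" if "B \<subseteq> A" for B f
    using finite_subset[OF that fin] that
    by (induction B rule: finite_induct) (use one mult pow in auto)
  hence "good k" using assms by (auto simp: prime_power_products_def)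
  thus ?thesis by (simp add: good_def)
qed

text \<open>\<open>I\<close> is the weighted second moment of the resonator and \<open>J\<close> the
  same moment against \<open>Re D\<close>. Positivity gives \<open>J >= S * I\<close> and
  \<open>I >= T / 2\<close>; the bound \<open>M\<close> on \<open>{a..T}\<close> and a trivial one
  on \<open>{0..a}\<close> bound \<open>J\<close> from above.\<close>

theorem resonance_bound:
  assumes T: "T > 0" and a: "0 \<le> a" "a \<le> T" and M: "M \<ge> 0"
    and sub: "prime_power_products A E \<subseteq> {1..N}"
    and le: "\<And>t. t \<in> {a..T} \<Longrightarrow> Re (dirichlet_sum N t) \<le> M"
  shows "(\<Sum>k\<in>prime_power_products A E. mult_ext q k / k)
           \<le> M + 2 * a * harm N * (\<Prod>p\<in>A. 1 / (1 - q p))\<^sup>2 / T"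
proof -
  let ?K = "prime_power_products A E"
  let ?R = "resonator A q" and ?D = "dirichlet_sum N"
  define S where "S = (\<Sum>k\<in>?K. mult_ext q k / k)"
  define B where "B = (\<Prod>p\<in>A. 1 / (1 - q p))"
  define w where "w = (\<lambda>t. 1 - t / T)"
  define I where "I = integral {0..T} (\<lambda>t. w t * (norm (?R t))\<^sup>2)"
  define J where "J = integral {0..T} (\<lambda>t. w t * (Re (?D t) * (norm (?R t))\<^sup>2))"
  have cont_w: "continuous_on X w" for X unfolding w_def using T by (intro continuous_intros) auto
  note cont = positive_ap_continuous[OF positive_ap_resonator] positive_ap_continuous[OF positive_ap_dirichlet_sum]
  have int_I: "(\<lambda>t. w t * (norm (?R t))\<^sup>2) integrable_on {x..y}" for x y
    by (intro integrable_continuous_real continuous_intros cont_w cont)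
  have int_J: "(\<lambda>t. w t * (Re (?D t) * (norm (?R t))\<^sup>2)) integrable_on {x..y}" for x y
    by (intro integrable_continuous_real continuous_intros cont_w cont)
  have w: "0 \<le> w t" "w t \<le> 1" if "t \<in> {0..T}" for t using that T by (auto simp: w_def)
  have B0: "B \<ge> 0" unfolding B_def using q by (intro prod_nonneg) (auto simp: less_imp_le)
  have norm_R: "(norm (?R t))\<^sup>2 \<le> B\<^sup>2" for t
    unfolding B_def by (intro power_mono norm_resonator_le) auto
  have R_cnj: "?R t * cnj (?R t) = of_real ((norm (?R t))\<^sup>2)" for t
    by (metis complex_norm_square of_real_power)

  \<comment> \<open>\<open>|R|^2 - 1 = (R - 1) * cnj R + cnj (R - 1)\<close> has nonnegative
    coefficients, and the weight alone integrates to \<open>T / 2\<close>.\<close>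
  have "I \<ge> T / 2"
  proof -
    have "positive_ap (\<lambda>t. (?R t - 1) * cnj (?R t) + cnj (?R t - 1))"
      by (intro positive_ap_add positive_ap_mult positive_ap_cnj positive_ap_resonator
            positive_ap_resonator_minus_one)
    moreover have "(?R t - 1) * cnj (?R t) + cnj (?R t - 1) = of_real ((norm (?R t))\<^sup>2 - 1)" for t
      by (simp add: left_diff_distrib R_cnj)
    ultimately have "positive_ap (\<lambda>t. of_real ((norm (?R t))\<^sup>2 - 1))" by (simp only:)
    from positive_ap_integral_nonneg[OF this T]
    have "0 \<le> integral {0..T} (\<lambda>t. w t * ((norm (?R t))\<^sup>2 - 1))"
      by (simp only: Re_complex_of_real w_def)
    also have "(\<lambda>t. w t * ((norm (?R t))\<^sup>2 - 1)) = (\<lambda>t. w t * (norm (?R t))\<^sup>2 - w t)"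
      by (simp add: right_diff_distrib)
    also have "integral {0..T} \<dots> = I - T / 2"
    proof -
      have "(w has_integral T / 2) {0..T}" using fejer_integral_cos[OF T, of 0] by (simp add: w_def)
      thus ?thesis unfolding I_def using int_I
        by (subst integral_diff) (auto simp: integral_unique has_integral_integrable)
    qed
    finally show ?thesis by simp
  qed

  \<comment> \<open>Each \<open>k\<close> in \<open>?K\<close> is handled by
    \<open>positive_ap_shift\<close>; the other \<open>k <= N\<close> contribute nonnegative
    coefficients as they are. Together they make up \<open>(D - S) * R * cnj R\<close>.\<close>
  have "J \<ge> S * I"
  proof -
    have fK: "finite ?K" by (intro finite_prime_power_products fin)
    have "positive_ap (\<lambda>t. ((\<Sum>k\<in>?K. of_real (1 / k) * ((cis (- ln (real k) * t) - of_real (mult_ext q k)) * ?R t))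
      + (\<Sum>k\<in>{1..N} - ?K. of_real (1 / k) * cis (- ln (real k) * t)) * ?R t) * cnj (?R t))" (is "positive_ap ?h")
      by (intro positive_ap_mult[OF _ positive_ap_cnj] positive_ap_add positive_ap_resonator positive_ap_sum
        positive_ap_mult[OF positive_ap_const positive_ap_shift] positive_ap_mult[OF positive_ap_sum] positive_ap_cis fK) auto
    moreover have "?h t = (?D t - of_real S) * (?R t * cnj (?R t))" for t
    proof -
      have "?D t = (\<Sum>k\<in>{1..N} - ?K. of_real (1 / k) * cis (- ln (real k) * t)) + (\<Sum>k\<in>?K. of_real (1 / k) * cis (- ln (real k) * t))"
        unfolding dirichlet_sum_def using sub by (intro sum.subset_diff) auto
      moreover have "(\<Sum>k\<in>?K. of_real (1 / k) * ((cis (- ln (real k) * t) - of_real (mult_ext q k)) * ?R t))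
         = ((\<Sum>k\<in>?K. of_real (1 / k) * cis (- ln (real k) * t)) - of_real S) * ?R t"
        unfolding S_def of_real_sum sum_subtractf[symmetric] sum_distrib_right
        by (intro sum.cong refl) (simp add: algebra_simps)
      moreover have "(U + W * R) * C = (D - s) * (R * C)" if "D = W + V" "U = (V - s) * R"
        for U V W D s R C :: complex unfolding that by (simp add: algebra_simps)
      ultimately show ?thesis by blast
    qed
    moreover have "Re ((?D t - of_real S) * (?R t * cnj (?R t))) = Re (?D t) * (norm (?R t))\<^sup>2 - S * (norm (?R t))\<^sup>2" for t
      unfolding R_cnj by (simp add: algebra_simps)
    ultimately have "positive_ap (\<lambda>t. (?D t - of_real S) * (?R t * cnj (?R t)))"
      and "integral {0..T} (\<lambda>t. (1 - t / T) * Re ((?D t - of_real S) * (?R t * cnj (?R t))))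
        = integral {0..T} (\<lambda>t. w t * (Re (?D t) * (norm (?R t))\<^sup>2 - S * (norm (?R t))\<^sup>2))"
      by (simp_all only: w_def)
    hence "0 \<le> integral {0..T} (\<lambda>t. w t * (Re (?D t) * (norm (?R t))\<^sup>2 - S * (norm (?R t))\<^sup>2))"
      using positive_ap_integral_nonneg[OF _ T] by metis
    also have "(\<lambda>t. w t * (Re (?D t) * (norm (?R t))\<^sup>2 - S * (norm (?R t))\<^sup>2))
       = (\<lambda>t. w t * (Re (?D t) * (norm (?R t))\<^sup>2) - S * (w t * (norm (?R t))\<^sup>2))"
      by (simp add: algebra_simps)
    also have "integral {0..T} \<dots> = J - S * I"
      unfolding I_def J_def using int_I int_J by (subst integral_diff) (auto intro!: integrable_on_mult_right)
    finally show ?thesis by simp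
  qed
  moreover have "J \<le> M * I + a * (harm N * B\<^sup>2)"
  proof -
    have "J = integral {0..a} (\<lambda>t. w t * (Re (?D t) * (norm (?R t))\<^sup>2)) + integral {a..T} (\<lambda>t. w t * (Re (?D t) * (norm (?R t))\<^sup>2))"
      unfolding J_def using a int_J by (intro Henstock_Kurzweil_Integration.integral_combine[symmetric]) auto
    also have "integral {0..a} (\<lambda>t. w t * (Re (?D t) * (norm (?R t))\<^sup>2)) \<le> integral {0..a} (\<lambda>t. harm N * B\<^sup>2)"
    proof (intro integral_le int_J)
      fix t assume t: "t \<in> {0..a}"
      have "w t * (Re (?D t) * (norm (?R t))\<^sup>2) \<le> w t * (harm N * B\<^sup>2)"
        using t a w[of t] norm_R[of t] order_trans[OF complex_Re_le_cmod norm_dirichlet_sum_le[of N t]]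
        by (intro mult_left_mono mult_mono) (auto simp: harm_nonneg)
      also have "\<dots> \<le> 1 * (harm N * B\<^sup>2)"
        using t a w[of t] by (intro mult_right_mono) (auto simp: harm_nonneg)
      finally show "w t * (Re (?D t) * (norm (?R t))\<^sup>2) \<le> harm N * B\<^sup>2" by simp
    qed auto
    also have "integral {0..a} (\<lambda>t. harm N * B\<^sup>2) = a * (harm N * B\<^sup>2)" using a by simp
    also have "integral {a..T} (\<lambda>t. w t * (Re (?D t) * (norm (?R t))\<^sup>2)) \<le> integral {a..T} (\<lambda>t. M * (w t * (norm (?R t))\<^sup>2))"
    proof (intro integral_le int_J integrable_on_mult_right int_I)
      fix t assume t: "t \<in> {a..T}"
      have "(w t * (norm (?R t))\<^sup>2) * Re (?D t) \<le> (w t * (norm (?R t))\<^sup>2) * M"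
        using t a w[of t] by (intro mult_left_mono le) auto
      thus "w t * (Re (?D t) * (norm (?R t))\<^sup>2) \<le> M * (w t * (norm (?R t))\<^sup>2)" by (simp add: algebra_simps)
    qed
    also have "\<dots> = M * integral {a..T} (\<lambda>t. w t * (norm (?R t))\<^sup>2)" by simp
    \<comment> \<open>Since \<open>M >= 0\<close> and the integrand is nonnegative, the range may be
      enlarged to \<open>{0..T}\<close>.\<close>
    also have "\<dots> \<le> M * I"
    proof (rule mult_left_mono[OF _ M])
      show "integral {a..T} (\<lambda>t. w t * (norm (?R t))\<^sup>2) \<le> I"
        unfolding I_def using a w by (intro integral_subset_le int_I) auto
    qed
    finally show ?thesis by simp
  qed
  ultimately have "(S - M) * I \<le> a * (harm N * B\<^sup>2)" by (simp add: algebra_simps)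
  have "S - M \<le> 2 * a * harm N * B\<^sup>2 / T"
  \<comment> \<open>\<open>I >= T / 2\<close> may be multiplied by \<open>S - M\<close> only if this
    is nonnegative; otherwise the claim is trivial.\<close>
  proof (cases "S \<ge> M")
    case True
    have "(S - M) * (T / 2) \<le> (S - M) * I" using True \<open>I \<ge> T / 2\<close> by (intro mult_left_mono) auto
    hence "(S - M) * (T / 2) \<le> a * (harm N * B\<^sup>2)" using \<open>(S - M) * I \<le> _\<close> by linarith
    thus ?thesis using T by (simp add: field_simps)
  next
    case False
    moreover have "0 \<le> 2 * a * harm N * B\<^sup>2 / T" using a T by (simp add: harm_nonneg)
    ultimately show ?thesis by linarith
  qed
  thus ?thesis by (simp add: S_def B_def)
qed

end

subsection \<open>The choice of the resonator\<close>

text \<open>Chosen so that \<open>1 / (1 - resonator_weight X p) = X / p\<close>: the maximum of the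
  resonator is the product of the \<open>X / p\<close>, while
  \<open>resonator_weight X p / p = 1 / p - 1 / X\<close> stays close to
  \<open>1 / p\<close>.\<close>

definition resonator_weight :: "nat \<Rightarrow> nat \<Rightarrow> real" where
  "resonator_weight X p = 1 - p / X"

lemma resonator_weight_bounds:
  assumes "p \<in> primes_upto X"
  shows "0 \<le> resonator_weight X p" "resonator_weight X p < 1"
  using assms primes_upto_ge_2[OF assms] by (auto simp: resonator_weight_def primes_upto_def)

text \<open>There are at most \<open>X\<close> primes, each with a power of at most
  \<open>X ^ X\<close>. So crude a bound suffices, since the length of the Dirichlet sum matters
  only through its logarithm.\<close>

lemma prime_power_products_subset:
  assumes "X \<ge> 1"
  shows "prime_power_products (primes_upto X) X \<subseteq> {1..X ^ (X * X)}"
proof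
  fix k assume "k \<in> prime_power_products (primes_upto X) X"
  then obtain f where f: "f \<in> primes_upto X \<rightarrow>\<^sub>E {..X}" "k = (\<Prod>p\<in>primes_upto X. p ^ f p)"
    by (auto simp: prime_power_products_def)
  have "k \<le> (\<Prod>p\<in>primes_upto X. X ^ X)" unfolding f(2)
  proof (intro prod_mono conjI)
    fix p assume p: "p \<in> primes_upto X"
    have "p ^ f p \<le> X ^ f p" using p by (intro power_mono) (auto simp: primes_upto_def)
    also have "\<dots> \<le> X ^ X" using assms f(1) p by (intro power_increasing) (auto simp: PiE_iff)
    finally show "p ^ f p \<le> X ^ X" .
  qed auto
  also have "\<dots> = X ^ (X * card (primes_upto X))" by (simp add: power_mult)
  also have "\<dots> \<le> X ^ (X * X)"
  proof (intro power_increasing mult_left_mono)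
    have "primes_upto X \<subseteq> {1..X}" by (auto simp: primes_upto_def prime_gt_0_nat Suc_le_eq)
    thus "card (primes_upto X) \<le> X" by (metis card_atLeastAtMost card_mono diff_Suc_1 finite_atLeastAtMost)
  qed (use assms in auto)
  finally have "k \<le> X ^ (X * X)" .
  moreover have "k > 0" unfolding f(2) by (intro prod_pos) (auto dest: primes_upto_ge_2)
  ultimately show "k \<in> {1..X ^ (X * X)}" by auto
qed

text \<open>With \<open>x = 1 / p - 1 / X\<close>, the sum is
  \<open>(1 - x ^ Suc X) / (1 - x)\<close>. Truncation loses a factor \<open>1 - 1 / X\<close> and
  passing from \<open>x\<close> to \<open>1 / p\<close> a factor \<open>1 - 2 / X\<close>. The
  product is at least \<open>1 - 3 / X\<close>, hence at least \<open>exp (- 6 / X)\<close> because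
  \<open>3 / X <= 1 / 2\<close>.\<close>

lemma smooth_factor_ge:
  fixes p X :: nat
  assumes p: "p \<in> primes_upto X" and X: "X \<ge> 6"
  shows "(\<Sum>e\<le>X. (resonator_weight X p / p) ^ e) \<ge> exp (- 6 / X) * (1 / (1 - 1 / p))"
proof -
  define x where "x = resonator_weight X p / p"
  have p2: "p \<ge> 2" by (rule primes_upto_ge_2[OF p])
  have x: "0 \<le> x" "x \<le> 1 / 2"
    using resonator_weight_bounds[OF p] p2 frac_le[of 1 "resonator_weight X p" 2 p] by (auto simp: x_def)
  have X0: "real X \<ge> 6" using X by simp
  have "x ^ Suc X \<le> (1 / 2) ^ Suc X" using x by (intro power_mono) auto
  also have "\<dots> \<le> 1 / X"
  proof -
    have "X < 2 ^ X" by (rule less_exp)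
    hence "real X < 2 ^ X" by (simp add: of_nat_less_numeral_power_cancel_iff)
    hence le: "real X \<le> 2 ^ Suc X" unfolding power_Suc by linarith
    have "1 / 2 ^ Suc X \<le> 1 / real X" using X0 by (intro divide_left_mono le mult_pos_pos) auto
    thus ?thesis by (simp only: power_one_over)
  qed
  finally have pow: "x ^ Suc X \<le> 1 / X" .
  have "exp (- 6 / X) \<le> 1 - 3 / X"
  proof -
    define y where "y = 3 / real X"
    have y: "0 \<le> y" "y \<le> 1 / 2" using X0 by (auto simp: y_def pos_divide_le_eq)
    have "1 + 2 * y \<le> exp (2 * y)" by (rule exp_ge_add_one_self)
    hence "1 \<le> (1 - y) * exp (2 * y)"
      using mult_left_mono[of "1 + 2 * y" "exp (2 * y)" "1 - y"] y
        mult_nonneg_nonneg[of y "1 - 2 * y"] by (simp add: algebra_simps)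
    hence "exp (- (2 * y)) \<le> 1 - y" by (simp add: exp_minus field_simps)
    thus ?thesis by (simp add: y_def)
  qed
  also have "\<dots> \<le> (1 - 1 / X) * (1 - 2 / X)"
  proof -
    have "(1 - 1 / X) * (1 - 2 / X) = 1 - 3 / X + 2 * (1 / real X)\<^sup>2"
      by (simp add: ring_distribs diff_divide_distrib power2_eq_square)
    thus ?thesis by (metis le_add_same_cancel1 zero_le_power2 mult_nonneg_nonneg zero_le_numeral)
  qed
  also have "\<dots> \<le> (1 - x ^ Suc X) * ((1 - 1 / p) / (1 - x))"
  proof (rule mult_mono)
    have x_eq: "1 - x = 1 - 1 / p + 1 / X" using p2 X0 by (simp add: x_def resonator_weight_def field_simps)
    have "(1 - 2 / X) * (1 - 1 / p + 1 / X) \<le> 1 - 1 / p"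
    proof -
      have "1 / real p \<le> 1 / 2" using p2 by (simp add: field_simps)
      hence "1 / X * (2 - 2 * (1 / p)) \<ge> 1 / X * 1" using X0 by (intro mult_left_mono) auto
      moreover have "1 / X * (1 / X) \<ge> 0" by simp
      moreover have "(1 - 2 / X) * (1 - 1 / p + 1 / X) = 1 - 1 / p + 1 / X - 1 / X * (2 - 2 * (1 / p)) - 2 * (1 / X * (1 / X))"
        by (simp add: ring_distribs diff_divide_distrib add_divide_distrib)
      ultimately show ?thesis by linarith
    qed
    hence "(1 - 2 / X) * (1 - x) \<le> 1 - 1 / p" by (simp only: x_eq)
    thus "1 - 2 / X \<le> (1 - 1 / p) / (1 - x)" using x by (subst pos_le_divide_eq) auto
  qed (use pow x X0 p2 power_le_one[of x "Suc X"] in auto)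
  finally have "exp (- 6 / X) * (1 / (1 - 1 / p)) \<le> (1 - x ^ Suc X) * ((1 - 1 / p) / (1 - x)) * (1 / (1 - 1 / p))"
    using p2 by (intro mult_right_mono) auto
  also have "\<dots> = (1 - x ^ Suc X) / (1 - x)" using p2 by simp
  also have "\<dots> = (\<Sum>e\<le>X. x ^ e)" using x by (subst sum_gp0) auto
  finally show ?thesis by (simp add: x_def)
qed

text \<open>There are \<open>O(X / ln X)\<close> primes, each losing a factor
  \<open>exp (- 6 / X)\<close>. Altogether the loss is a factor \<open>1 - O(1 / ln X)\<close>,
  which against the \<open>ln X\<close> of Mertens' third theorem is an additive constant.\<close>

lemma smooth_sum_lower:
  obtains C where "eventually (\<lambda>X. (\<Sum>k\<in>prime_power_products (primes_upto X) X.
      mult_ext (resonator_weight X) k / k) \<ge> exp euler_mascheroni * (ln (real X) - C)) at_top"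
proof -
  obtain C where C: "C \<ge> 0"
    "\<And>n. n \<ge> 2 \<Longrightarrow> (\<Prod>p\<in>primes_upto n. 1 / (1 - 1 / real p)) \<ge> exp euler_mascheroni * (ln n - C)"
    using mertens_third_lower by blast
  define B where "B = (2 + 2 * ln 4 :: real)"
  have "eventually (\<lambda>X::nat. X \<ge> 6 \<and> ln (real X) \<ge> C) at_top"
    by (intro eventually_conj eventually_ge_at_top) real_asymp
  hence "eventually (\<lambda>X. (\<Sum>k\<in>prime_power_products (primes_upto X) X.
      mult_ext (resonator_weight X) k / k) \<ge> exp euler_mascheroni * (ln (real X) - (C + 6 * B))) at_top"
  proof eventually_elim
    case (elim X)
    hence X: "X \<ge> 6" and lnX: "ln (real X) \<ge> C" by auto
    let ?P = "primes_upto X"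
    have ln0: "ln (real X) > 0" using X by simp
    have "exp (- (6 * card ?P / X)) * (\<Prod>p\<in>?P. 1 / (1 - 1 / real p))
        = exp (- 6 / X) ^ card ?P * (\<Prod>p\<in>?P. 1 / (1 - 1 / real p))"
      by (simp add: mult.commute flip: exp_of_nat_mult)
    also have "\<dots> = (\<Prod>p\<in>?P. exp (- 6 / X) * (1 / (1 - 1 / real p)))"
      by (simp only: prod.distrib prod_constant)
    also have "\<dots> \<le> (\<Prod>p\<in>?P. \<Sum>e\<le>X. (resonator_weight X p / p) ^ e)"
      using X by (intro prod_mono conjI smooth_factor_ge) (auto dest: primes_upto_ge_2)
    also have "\<dots> = (\<Prod>p\<in>?P. \<Sum>e\<le>X. (mult_ext (resonator_weight X) p / p) ^ e)"
      by (intro prod.cong refl) (auto simp: primes_upto_def mult_ext_prime)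
    also have "\<dots> = (\<Sum>k\<in>prime_power_products ?P X. mult_ext (resonator_weight X) k / k)"
      by (intro sum_prime_power_products[symmetric])
        (auto simp: primes_upto_def mult_ext_1[simplified] mult_ext_mult)
    finally have S: "exp (- (6 * card ?P / X)) * (\<Prod>p\<in>?P. 1 / (1 - 1 / real p)) \<le> \<dots>" .
    have "card ?P \<le> B * (X / ln X)" unfolding B_def using X by (intro card_primes_upto_le) auto
    hence card: "6 * card ?P / X \<le> 6 * B / ln X" using X ln0 by (simp add: field_simps)
    have "ln X - (C + 6 * B) \<le> (1 - 6 * B / ln X) * (ln X - C)"
    proof -
      have "6 * B / ln X * C \<ge> 0" using C(1) ln0 by (simp add: B_def)
      moreover have "6 * B / ln X * ln X = 6 * B" using ln0 by simp
      moreover have "(1 - u) * (l - C) = l - C - u * l + u * C" for u l :: real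
        by (simp add: algebra_simps)
      ultimately show ?thesis by simp
    qed
    also have "\<dots> \<le> exp (- (6 * card ?P / X)) * (ln X - C)"
      using exp_ge_add_one_self[of "- (6 * card ?P / X)"] card lnX by (intro mult_right_mono) auto
    finally have "exp euler_mascheroni * (ln (real X) - (C + 6 * B))
        \<le> exp euler_mascheroni * (exp (- (6 * card ?P / X)) * (ln X - C))"
      by (intro mult_left_mono) auto
    also have "\<dots> = exp (- (6 * card ?P / X)) * (exp euler_mascheroni * (ln X - C))" by simp
    also have "\<dots> \<le> exp (- (6 * card ?P / X)) * (\<Prod>p\<in>?P. 1 / (1 - 1 / real p))"
      using X by (intro mult_left_mono C(2)) auto
    also note S
    finally show ?case .
  qed
  thus ?thesis using that by blast
qed

lemma resonator_sup_le:
  obtains C where "C \<ge> 0"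
    "\<And>X. X \<ge> 2 \<Longrightarrow> (\<Prod>p\<in>primes_upto X. 1 / (1 - resonator_weight X p)) \<le> exp (C * (X / ln X))"
proof -
  obtain C where C: "C \<ge> 0"
    "\<And>n. n \<ge> 2 \<Longrightarrow> (\<Sum>p\<in>primes_upto n. ln (real n) - ln (real p)) \<le> C * (n / ln n)"
    using sum_ln_deficit_le by blast
  show ?thesis
  proof (rule that[OF C(1)])
    fix X :: nat assume X: "X \<ge> 2"
    have "(\<Prod>p\<in>primes_upto X. 1 / (1 - resonator_weight X p)) = (\<Prod>p\<in>primes_upto X. exp (ln (real X) - ln (real p)))"
    proof (intro prod.cong refl)
      fix p assume "p \<in> primes_upto X"
      note p = primes_upto_ge_2[OF this]
      show "1 / (1 - resonator_weight X p) = exp (ln (real X) - ln (real p))"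
        using p X by (simp add: resonator_weight_def exp_diff)
    qed
    also have "\<dots> = exp (\<Sum>p\<in>primes_upto X. ln (real X) - ln (real p))" by (simp add: exp_sum)
    also have "\<dots> \<le> exp (C * (X / ln X))" using C(2)[OF X] by simp
    finally show "(\<Prod>p\<in>primes_upto X. 1 / (1 - resonator_weight X p)) \<le> exp (C * (X / ln X))" .
  qed
qed

section \<open>Choice of parameters and conclusion\<close>

lemma harm_le_ln: "n \<ge> 1 \<Longrightarrow> harm n \<le> 1 + ln (real n)"
proof (induction n rule: nat_induct_at_least)
  case (Suc n)
  have "ln (real n / real (Suc n)) \<le> real n / real (Suc n) - 1" using Suc.hyps by (intro ln_le_minus_one) auto
  hence "1 / real (Suc n) \<le> ln (real (Suc n)) - ln (real n)"
    using Suc.hyps by (simp add: ln_divide_pos field_simps)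
  thus ?case using Suc by (simp add: harm_Suc inverse_eq_divide)
qed (auto simp: harm_def)

theorem theorem1:
  shows "\<exists>C::real. \<forall>\<^sub>F T::real in at_top.
           \<exists>t\<in>{sqrt T..T}.
             (\<forall>u\<in>{sqrt T..T}. cmod (riemann_zeta (1 + \<i> * of_real u))
                               \<le> cmod (riemann_zeta (1 + \<i> * of_real t))) \<and>
             cmod (riemann_zeta (1 + \<i> * of_real t))
               \<ge> exp euler_mascheroni * (ln (ln T) + ln (ln (ln T)) - C)"
proof -
  obtain C1 where C1: "eventually (\<lambda>X. (\<Sum>k\<in>prime_power_products (primes_upto X) X.
      mult_ext (resonator_weight X) k / k) \<ge> exp euler_mascheroni * (ln (real X) - C1)) at_top"
    using smooth_sum_lower by blast
  obtain C2 where C2: "C2 \<ge> 0"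
    "\<And>X. X \<ge> 2 \<Longrightarrow> (\<Prod>p\<in>primes_upto X. 1 / (1 - resonator_weight X p)) \<le> exp (C2 * (X / ln X))"
    using resonator_sup_le by blast
  \<comment> \<open>The constant makes \<open>C2 * c <= 1 / 16\<close>, so the squared maximum of
    the resonator is at most \<open>exp (ln T / 8)\<close>.\<close>
  define c where "c = 1 / (16 * (C2 + 1))"
  have c: "c > 0" using C2(1) by (simp add: c_def)
  define X where "X = (\<lambda>T. nat \<lfloor>c * ln T * ln (ln T)\<rfloor>)"
  have X_lim: "filterlim X at_top at_top"
    unfolding X_def
    by (rule filterlim_compose[OF filterlim_nat_sequentially filterlim_compose[OF filterlim_floor_sequentially]])
      (use c in real_asymp)
  \<comment> \<open>The first three conditions serve, in this order, to give
    \<open>ln T <= X T\<close>, to bound \<open>X T\<close> by \<open>(ln T) ^ 2\<close>, and to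
    absorb the harmonic sum into \<open>T powr (1 / 4)\<close>.\<close>
  have "eventually (\<lambda>T. c * ln T * ln (ln T) \<ge> ln T + 1) at_top" using c by real_asymp
  moreover have "eventually (\<lambda>T. c * ln T * ln (ln T) \<le> (ln T)\<^sup>2) at_top" using c by real_asymp
  moreover have "eventually (\<lambda>T::real. 2 * (1 + (ln T) ^ 6) \<le> T powr (1 / 4)) at_top" by real_asymp
  moreover have "eventually (\<lambda>T::real. ln (ln T) \<ge> 1) at_top" by real_asymp
  moreover have "eventually (\<lambda>T::real. ln T \<ge> 3) at_top" by real_asymp
  moreover have "eventually (\<lambda>T::real. T \<ge> 1) at_top" by real_asymp
  moreover have "eventually (\<lambda>T. (\<Sum>k\<in>prime_power_products (primes_upto (X T)) (X T).
      mult_ext (resonator_weight (X T)) k / k) \<ge> exp euler_mascheroni * (ln (real (X T)) - C1)) at_top"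
    by (rule eventually_compose_filterlim[OF C1 X_lim])
  \<comment> \<open>In the constant, \<open>ln (c / 2)\<close> comes from
    \<open>X T >= (c / 2) * ln T * ln (ln T)\<close>, and \<open>4 = 3 + 1\<close> collects the
    approximation of zeta and the range below \<open>sqrt T\<close>.\<close>
  ultimately have "eventually (\<lambda>T::real. \<exists>t\<in>{sqrt T..T}.
             (\<forall>u\<in>{sqrt T..T}. cmod (riemann_zeta (1 + \<i> * of_real u))
                               \<le> cmod (riemann_zeta (1 + \<i> * of_real t))) \<and>
             cmod (riemann_zeta (1 + \<i> * of_real t))
               \<ge> exp euler_mascheroni * (ln (ln T) + ln (ln (ln T)) - (C1 - ln (c / 2) + 4))) at_top"
  proof eventually_elim
    case (elim T)
    define Y where "Y = X T"
    define x where "x = c * ln T * ln (ln T)"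
    \<comment> \<open>Large enough to cover all of
      \<open>prime_power_products (primes_upto Y) Y\<close>, and at least \<open>T\<close>.\<close>
    define N where "N = Y ^ (Y * Y)"
    have T1: "T \<ge> 1" and lnT: "ln T \<ge> 3" and lnlnT: "ln (ln T) \<ge> 1" using elim by auto
    have sqrt_le: "1 \<le> sqrt T" "sqrt T \<le> T" using T1 real_sqrt_le_mono[of T "T\<^sup>2"]
      by (auto simp: power2_eq_square)
    have Y_le: "real Y \<le> x" and Y_gt: "real Y > x - 1"
      using elim(1) lnT unfolding Y_def X_def x_def[symmetric] by linarith+
    have Y_ge: "real Y \<ge> ln T" using Y_gt elim(1) by (simp add: x_def)
    have Y3: "Y \<ge> 3" using Y_ge lnT by simp
    have lnY0: "ln (real Y) > 0" using Y3 by simp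
    have Y_le2: "real Y \<le> (ln T)\<^sup>2" using Y_le elim(2) by (simp add: x_def)
    have "ln (ln T) \<le> ln (real Y)" using Y_ge lnT by (subst ln_le_cancel_iff) auto
    hence "x / ln Y \<le> x / ln (ln T)"
      using lnlnT lnT c by (intro divide_left_mono mult_pos_pos) (auto simp: x_def)
    also have "\<dots> = c * ln T" using lnlnT by (simp add: x_def)
    finally have "real Y / ln Y \<le> c * ln T"
      using divide_right_mono[OF Y_le, of "ln Y"] lnY0 by linarith
    hence "C2 * (Y / ln Y) \<le> C2 * (c * ln T)" by (rule mult_left_mono[OF _ C2(1)])
    also have "\<dots> \<le> ln T / 16"
    proof -
      have "C2 * c \<le> 1 / 16" using C2(1) by (simp add: c_def field_simps)
      thus ?thesis using mult_right_mono[of "C2 * c" "1 / 16" "ln T"] lnT by simp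
    qed
    finally have "exp (C2 * (Y / ln Y)) \<le> exp (ln T / 16)" by simp
    moreover have "(\<Prod>p\<in>primes_upto Y. 1 / (1 - resonator_weight Y p)) \<le> exp (C2 * (Y / ln Y))"
      using Y3 by (intro C2(2)) simp
    ultimately have "(\<Prod>p\<in>primes_upto Y. 1 / (1 - resonator_weight Y p)) \<le> exp (ln T / 16)"
      by linarith
    hence "(\<Prod>p\<in>primes_upto Y. 1 / (1 - resonator_weight Y p))\<^sup>2 \<le> (exp (ln T / 16))\<^sup>2"
      using resonator_weight_bounds[of _ Y] by (intro power_mono prod_nonneg) (auto simp: less_imp_le)
    also have "\<dots> = exp (ln T / 8)" by (simp flip: exp_double)
    also have "\<dots> \<le> T powr (1 / 4)" using T1 lnT by (simp add: powr_def)
    finally have sup: "(\<Prod>p\<in>primes_upto Y. 1 / (1 - resonator_weight Y p))\<^sup>2 \<le> T powr (1 / 4)" .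
    have "ln (real N) = real (Y * Y) * ln Y" by (simp add: N_def ln_realpow)
    also have "\<dots> \<le> real (Y * Y) * Y" using ln_le_minus_one[of "real Y"] Y3 by (intro mult_left_mono) auto
    also have "\<dots> = real Y ^ 3" by (simp add: power3_eq_cube)
    also have "\<dots> \<le> ((ln T)\<^sup>2) ^ 3" using Y_le2 by (intro power_mono) auto
    finally have "ln (real N) \<le> (ln T) ^ 6" by simp
    moreover have "harm N \<le> 1 + ln (real N)" unfolding N_def using Y3 by (intro harm_le_ln) simp
    ultimately have harm: "2 * harm N \<le> T powr (1 / 4)" using elim(3) by simp
    \<comment> \<open>Besides \<open>sqrt T\<close>, the harmonic factor and the squared maximum are
      at most \<open>T powr (1 / 4)\<close> each, so the numerator is at most
      \<open>T\<close>.\<close>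
    have err: "2 * sqrt T * harm N * (\<Prod>p\<in>primes_upto Y. 1 / (1 - resonator_weight Y p))\<^sup>2 / T \<le> 1"
    proof -
      have "(2 * harm N) * (\<Prod>p\<in>primes_upto Y. 1 / (1 - resonator_weight Y p))\<^sup>2 \<le> T powr (1 / 4) * T powr (1 / 4)"
        by (intro mult_mono harm sup) auto
      also have "\<dots> = sqrt T" using T1 by (simp flip: powr_add add: powr_half_sqrt)
      finally have "sqrt T * ((2 * harm N) * (\<Prod>p\<in>primes_upto Y. 1 / (1 - resonator_weight Y p))\<^sup>2) \<le> sqrt T * sqrt T"
        using T1 by (intro mult_left_mono) auto
      thus ?thesis using T1 by (simp add: field_simps)
    qed
    \<comment> \<open>\<open>exp 1 <= 3 <= Y\<close> is what lets the power of \<open>Y\<close>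
      dominate \<open>exp (Y * Y)\<close>.\<close>
    have "T = exp (ln T)" using T1 by simp
    also have "\<dots> \<le> exp Y" using Y_ge by simp
    also have "\<dots> \<le> exp 1 ^ (Y * Y)" using Y3 by (simp flip: exp_of_nat_mult)
    also have "\<dots> \<le> real Y ^ (Y * Y)" using Y3 exp_le by (intro power_mono) auto
    finally have N_ge: "T \<le> real N" by (simp add: N_def)

    have "continuous_on {sqrt T..T} (\<lambda>t. cmod (riemann_zeta (1 + \<i> * of_real t)))"
      using sqrt_le(1) by (intro continuous_on_norm continuous_on_subset[OF continuous_on_zeta_one_line])
        (use less_le_trans[OF zero_less_one order_trans[OF sqrt_le(1)]] in auto)
    moreover have "{sqrt T..T} \<noteq> {}" using sqrt_le by auto
    ultimately obtain t where t: "t \<in> {sqrt T..T}" "\<And>u. u \<in> {sqrt T..T} \<Longrightarrow>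
        cmod (riemann_zeta (1 + \<i> * of_real u)) \<le> cmod (riemann_zeta (1 + \<i> * of_real t))"
      using continuous_attains_sup[OF compact_Icc] by blast
    define M where "M = cmod (riemann_zeta (1 + \<i> * of_real t))"
    \<comment> \<open>The 3 is \<open>1 / u <= 1\<close> plus \<open>(1 + u) / N <= 2\<close>, the
      latter because \<open>u <= T <= N\<close>.\<close>
    have "Re (dirichlet_sum N u) \<le> M + 3" if u: "u \<in> {sqrt T..T}" for u
    proof -
      have u1: "u \<ge> 1" using u sqrt_le order_trans[of 1 "sqrt T" u] by simp
      have "cmod (riemann_zeta (1 + \<i> * of_real u) - dirichlet_sum N u) \<le> 1 / u + (1 + u) / N"
        unfolding dirichlet_sum_def using u1 Y3 by (intro norm_zeta_one_line_minus_sum_le) (auto simp: N_def)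
      also have "\<dots> \<le> 1 + 2"
      proof (rule add_mono)
        have "1 + u \<le> 2 * N" using u u1 N_ge T1 by auto
        thus "(1 + u) / N \<le> 2" using N_ge T1 by (simp add: pos_divide_le_eq)
      qed (use u1 in auto)
      finally have "cmod (dirichlet_sum N u) \<le> cmod (riemann_zeta (1 + \<i> * of_real u)) + 3"
        using norm_triangle_sub[of "dirichlet_sum N u" "riemann_zeta (1 + \<i> * of_real u)"]
        by (simp add: norm_minus_commute)
      thus ?thesis using t(2)[OF u] complex_Re_le_cmod[of "dirichlet_sum N u"] by (simp add: M_def)
    qed
    hence "(\<Sum>k\<in>prime_power_products (primes_upto Y) Y. mult_ext (resonator_weight Y) k / k)
        \<le> M + 3 + 2 * sqrt T * harm N * (\<Prod>p\<in>primes_upto Y. 1 / (1 - resonator_weight Y p))\<^sup>2 / T"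
      using sqrt_le T1 Y3 resonator_weight_bounds prime_power_products_subset[of Y]
      by (intro resonance_bound) (auto simp: primes_upto_def M_def N_def)
    hence "exp euler_mascheroni * (ln (real Y) - C1) \<le> M + 4"
      using elim(7) err by (simp add: Y_def)
    \<comment> \<open>As \<open>exp euler_mascheroni >= 1\<close>, the additive 4 can be moved
      inside the bracket.\<close>
    moreover have "exp euler_mascheroni \<ge> (1::real)" using euler_mascheroni_pos by simp
    moreover have "exp euler_mascheroni * (ln (real Y) - C1 - 4)
        = exp euler_mascheroni * (ln (real Y) - C1) - exp euler_mascheroni * 4"
      by (rule right_diff_distrib)
    ultimately have lower: "exp euler_mascheroni * (ln (real Y) - C1 - 4) \<le> M" by linarith
    have "ln (c / 2) + ln (ln T) + ln (ln (ln T)) = ln (c / 2 * ln T * ln (ln T))"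
    proof -
      have "c / 2 \<noteq> 0" "ln T \<noteq> 0" "ln (ln T) \<noteq> 0" using c lnT lnlnT by auto
      thus ?thesis by (simp only: ln_mult mult_eq_0_iff simp_thms if_True if_False)
    qed
    \<comment> \<open>Rounding down costs at most half of \<open>x\<close>, as
      \<open>x >= 2\<close>.\<close>
    also have "\<dots> \<le> ln (real Y)"
    proof (subst ln_le_cancel_iff)
      show "c / 2 * ln T * ln (ln T) \<le> real Y" using Y_gt elim(1) lnT by (simp add: x_def)
    qed (use c lnT lnlnT Y3 in auto)
    finally have "exp euler_mascheroni * (ln (ln T) + ln (ln (ln T)) - (C1 - ln (c / 2) + 4))
        \<le> exp euler_mascheroni * (ln (real Y) - C1 - 4)"
      by (intro mult_left_mono) auto
    with lower t show ?case unfolding M_def by (meson order_trans)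
  qed
  thus ?thesis by blast
qed

end
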